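(* Let $f=F'$ be differentiable with $\max_{\phi\in\mathbf{R}}|f'(\phi)|\le L$ for a non-negative constant $L$. Let $\varepsilon,\gamma,\tau>0$, and let $\phi^0,\phi^1$ be given. Let $(\phi^{n+1},\mu^{n+\frac12})$, $n\ge 1$, be generated by the SL-CN scheme $$\frac{\phi^{n+1}-\phi^{n}}{\tau}=\gamma\Delta \mu^{n+\frac{1}{2}},$$ $$\mu^{n+\frac{1}{2}}=-\varepsilon \Delta \Big(\frac{\phi^{n+1}+\phi^{n}}{2} \Big)+\frac{1}{\varepsilon}f\Big(\frac{3}{2}\phi^{n}-\frac{1}{2}\phi^{n-1}\Big)-A\tau \Delta \delta_{t}\phi^{n+1}+B\,\delta_{tt}\phi^{n+1},$$ where $A,B$ are non-negative constants. If $$A\geq \frac{L^{2}}{16\varepsilon^{2}}\gamma, \qquad B\geq \frac{L}{2\varepsilon},$$ then for all $n\ge 1$ $$E_{C}^{n+1}\leq E_{C}^{n}-\Big(2\sqrt{\frac{A}{\gamma}}-\frac{L}{2\varepsilon}\Big)\|\delta_{t}\phi^{n+1}\|^{2}-\Big(\frac{B}{2}-\frac{L}{4\varepsilon}\Big)\|\delta_{tt}\phi^{n+1}\|^{2},$$ where $$E_{C}^{n+1}=E_{\varepsilon}(\phi^{n+1})+\Big(\frac{L}{4\varepsilon}+\frac{B}{2}\Big)\|\delta_{t}\phi^{n+1}\|^{2}.$$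
   Context: $\Omega\subset\mathbf{R}^d$, $d=2,3$, is a bounded domain with locally Lipschitz boundary and outward normal $n$. The scheme discretizes in time the Cahn-Hilliard equation $\phi_t=\gamma\Delta\mu$, $\mu=-\varepsilon\Delta\phi+\frac1\varepsilon f(\phi)$ in $\Omega\times(0,T]$, $\phi|_{t=0}=\phi_0$, with homogeneous Neumann boundary conditions $\partial_n\phi=0$, $\partial_n\mu=0$ on $\partial\Omega$; the time-discrete functions $\phi^k$ and $\mu^{k+\frac12}$ satisfy the same homogeneous Neumann conditions and are assumed regular enough for the scheme to make sense. Here $f=F'$, where $F$ is a given potential, $\tau$ is the time step, $\phi^0=\phi_0$ and $\phi^1\approx\phi(\cdot,\tau)$ are given, and $n$ ranges over the steps $n=1,2,\dots,N=T/\tau-1$ of the scheme. Notation: $\|\cdot\|$ is the $L^2(\Omega)$ norm; $\delta_t\phi^{n+1}=\phi^{n+1}-\phi^n$; $\delta_{tt}\phi^{n+1}=\phi^{n+1}-2\phi^n+\phi^{n-1}$; and $$E_{\varepsilon}(\phi)=\int_{\Omega}\Big(\frac{\varepsilon}{2}|\nabla \phi|^{2}+\frac{1}{\varepsilon}F(\phi)\Big)dx .$$ *)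

theory Defs
  imports "HOL-Analysis.Analysis"
begin

definition grad :: "(real^'d \<Rightarrow> real) \<Rightarrow> real^'d \<Rightarrow> real^'d" where
  "grad \<psi> x = (\<chi> i. frechet_derivative \<psi> (at x) (axis i 1))"

primrec k_smooth :: "nat \<Rightarrow> (real^'d \<Rightarrow> real) \<Rightarrow> bool" where
  "k_smooth 0 \<psi> \<longleftrightarrow> continuous_on UNIV \<psi>"
| "k_smooth (Suc k) \<psi> \<longleftrightarrow>
     (\<forall>x. \<psi> differentiable (at x)) \<and> (\<forall>i. k_smooth k (\<lambda>x. grad \<psi> x $ i))"

definition test_functions :: "(real^'d) set \<Rightarrow> (real^'d \<Rightarrow> real) set" where
  "test_functions \<Omega> =
     {\<psi>. (\<forall>k. k_smooth k \<psi>) \<and> compact (closure {x. \<psi> x \<noteq> 0}) \<and> closure {x. \<psi> x \<noteq> 0} \<subseteq> \<Omega>}"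

text \<open>
  Near each boundary point, up to a rotation, the domain is the region below the graph of a
  Lipschitz function of the coordinates orthogonal to a unit vector \<open>\<nu>\<close>.
\<close>
definition lipschitz_boundary :: "(real^'d) set \<Rightarrow> bool" where
  "lipschitz_boundary \<Omega> \<longleftrightarrow>
     (\<forall>p\<in>frontier \<Omega>. \<exists>r>0. \<exists>\<nu> g K. norm \<nu> = 1 \<and> K-lipschitz_on {y. y \<bullet> \<nu> = 0} (g :: real^'d \<Rightarrow> real) \<and>
        \<Omega> \<inter> ball p r = {x \<in> ball p r. x \<bullet> \<nu> < g (x - (x \<bullet> \<nu>) *\<^sub>R \<nu>)})"

definition lipschitz_domain :: "(real^'d) set \<Rightarrow> bool" where
  "lipschitz_domain \<Omega> \<longleftrightarrow>
     open \<Omega> \<and> connected \<Omega> \<and> \<Omega> \<noteq> {} \<and> bounded \<Omega> \<and> lipschitz_boundary \<Omega>"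

definition L2 :: "(real^'d) set \<Rightarrow> (real^'d \<Rightarrow> 'b::euclidean_space) set" where
  "L2 \<Omega> = {u \<in> borel_measurable (lebesgue_on \<Omega>). integrable (lebesgue_on \<Omega>) (\<lambda>x. (norm (u x))\<^sup>2)}"

definition L2_norm :: "(real^'d) set \<Rightarrow> (real^'d \<Rightarrow> real) \<Rightarrow> real" where
  "L2_norm \<Omega> u = sqrt (integral\<^sup>L (lebesgue_on \<Omega>) (\<lambda>x. (u x)\<^sup>2))"

definition has_weak_gradient ::
  "(real^'d) set \<Rightarrow> (real^'d \<Rightarrow> real) \<Rightarrow> (real^'d \<Rightarrow> real^'d) \<Rightarrow> bool" where
  "has_weak_gradient \<Omega> u G \<longleftrightarrow> u \<in> L2 \<Omega> \<and> G \<in> L2 \<Omega> \<and>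
     (\<forall>\<psi>\<in>test_functions \<Omega>. \<forall>i.
        integral\<^sup>L (lebesgue_on \<Omega>) (\<lambda>x. u x * grad \<psi> x $ i) =
        - integral\<^sup>L (lebesgue_on \<Omega>) (\<lambda>x. G x $ i * \<psi> x))"

definition H1 :: "(real^'d) set \<Rightarrow> (real^'d \<Rightarrow> real) set" where
  "H1 \<Omega> = {u. \<exists>G. has_weak_gradient \<Omega> u G}"

text \<open>
  Weak gradients and weak divergences are unique only up to null sets; the operators below pick
  a representative.
\<close>
definition wgrad :: "(real^'d) set \<Rightarrow> (real^'d \<Rightarrow> real) \<Rightarrow> real^'d \<Rightarrow> real^'d" where
  "wgrad \<Omega> u = (SOME G. has_weak_gradient \<Omega> u G)"

definition has_weak_divergence ::
  "(real^'d) set \<Rightarrow> (real^'d \<Rightarrow> real^'d) \<Rightarrow> (real^'d \<Rightarrow> real) \<Rightarrow> bool" where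
  "has_weak_divergence \<Omega> G g \<longleftrightarrow> G \<in> L2 \<Omega> \<and> g \<in> L2 \<Omega> \<and>
     (\<forall>\<psi>\<in>test_functions \<Omega>.
        integral\<^sup>L (lebesgue_on \<Omega>) (\<lambda>x. G x \<bullet> grad \<psi> x) =
        - integral\<^sup>L (lebesgue_on \<Omega>) (\<lambda>x. g x * \<psi> x))"

definition H1_laplace :: "(real^'d) set \<Rightarrow> (real^'d \<Rightarrow> real) set" where
  "H1_laplace \<Omega> = {u \<in> H1 \<Omega>. \<exists>g. has_weak_divergence \<Omega> (wgrad \<Omega> u) g}"

definition wlaplace :: "(real^'d) set \<Rightarrow> (real^'d \<Rightarrow> real) \<Rightarrow> real^'d \<Rightarrow> real" where
  "wlaplace \<Omega> u = (SOME g. has_weak_divergence \<Omega> (wgrad \<Omega> u) g)"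

text \<open>
  On a Lipschitz domain, the normal derivative of an \<open>H\<^sup>1\<close> function \<open>u\<close> whose Laplacian is in
  \<open>L\<^sup>2\<close> is the functional acting on the boundary trace of \<open>v \<in> H\<^sup>1\<close> as below (the normal trace of
  \<open>\<nabla>u\<close> as a field with square-integrable divergence). For \<open>u\<close> smooth up to the boundary this is
  the boundary integral of \<open>(\<nabla>u \<bullet> n) v\<close>.
\<close>
definition normal_derivative :: "(real^'d) set \<Rightarrow> (real^'d \<Rightarrow> real) \<Rightarrow> (real^'d \<Rightarrow> real) \<Rightarrow> real" where
  "normal_derivative \<Omega> u v =
     integral\<^sup>L (lebesgue_on \<Omega>) (\<lambda>x. wgrad \<Omega> u x \<bullet> wgrad \<Omega> v x + wlaplace \<Omega> u x * v x)"

definition homogeneous_neumann :: "(real^'d) set \<Rightarrow> (real^'d \<Rightarrow> real) \<Rightarrow> bool" where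
  "homogeneous_neumann \<Omega> u \<longleftrightarrow> u \<in> H1_laplace \<Omega> \<and> (\<forall>v\<in>H1 \<Omega>. normal_derivative \<Omega> u v = 0)"

definition energy ::
  "(real^'d) set \<Rightarrow> real \<Rightarrow> (real \<Rightarrow> real) \<Rightarrow> (real^'d \<Rightarrow> real) \<Rightarrow> real" where
  "energy \<Omega> \<epsilon> F u =
     integral\<^sup>L (lebesgue_on \<Omega>) (\<lambda>x. \<epsilon> / 2 * (norm (wgrad \<Omega> u x))\<^sup>2 + 1 / \<epsilon> * F (u x))"

text \<open>Only meaningful for \<open>k \<ge> 1\<close> and \<open>k \<ge> 2\<close>, respectively (truncated subtraction).\<close>
definition delta_t :: "(nat \<Rightarrow> real^'d \<Rightarrow> real) \<Rightarrow> nat \<Rightarrow> real^'d \<Rightarrow> real" where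
  "delta_t \<phi> k x = \<phi> k x - \<phi> (k - 1) x"

definition delta_tt :: "(nat \<Rightarrow> real^'d \<Rightarrow> real) \<Rightarrow> nat \<Rightarrow> real^'d \<Rightarrow> real" where
  "delta_tt \<phi> k x = \<phi> k x - 2 * \<phi> (k - 1) x + \<phi> (k - 2) x"

definition modified_energy ::
  "(real^'d) set \<Rightarrow> real \<Rightarrow> (real \<Rightarrow> real) \<Rightarrow> real \<Rightarrow> real \<Rightarrow> (nat \<Rightarrow> real^'d \<Rightarrow> real) \<Rightarrow> nat \<Rightarrow> real" where
  "modified_energy \<Omega> \<epsilon> F L B \<phi> k =
     energy \<Omega> \<epsilon> F (\<phi> k) + (L / (4 * \<epsilon>) + B / 2) * (L2_norm \<Omega> (delta_t \<phi> k))\<^sup>2"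

end

theory Submission
  imports Defs
begin

text \<open>
  The scheme is an energy method. Let \<open>d = \<phi>\<^sup>n\<^sup>+\<^sup>1 - \<phi>\<^sup>n\<close>. Testing the first equation with \<open>\<mu>\<close> and the second
  with \<open>d\<close>, and integrating by parts with the Neumann conditions, gives an exact balance: the change
  of the gradient energy, plus \<open>(1/\<epsilon>) \<integral> f d\<close>, plus the contribution of \<open>B\<close>, equals
  \<open>- \<tau>\<gamma> \<parallel>\<nabla>\<mu>\<parallel>\<^sup>2 - A\<tau> \<parallel>\<nabla>d\<parallel>\<^sup>2\<close>. Testing the first equation with \<open>d\<close> gives
  \<open>\<parallel>d\<parallel>\<^sup>2 = - \<tau>\<gamma> \<integral> \<nabla>\<mu> \<bullet> \<nabla>d\<close>, so completing the square bounds the dissipation from below by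
  \<open>2 sqrt (A/\<gamma>) \<parallel>d\<parallel>\<^sup>2\<close>. The explicit nonlinearity is compared with \<open>F(\<phi>\<^sup>n\<^sup>+\<^sup>1) - F(\<phi>\<^sup>n)\<close> by Taylor expansion at
  the extrapolated point (\<open>extrapolated_potential_bound\<close>). The lemma \<open>energy_step\<close> combines these.
  
  The analytic work lies in making weak derivatives behave linearly. Gradient and Laplacian are
  arbitrary representatives of classes modulo null sets, so the Laplacian of \<open>(\<phi>\<^sup>n\<^sup>+\<^sup>1 + \<phi>\<^sup>n)/2\<close> in the scheme
  is related to those of its summands only through uniqueness of weak derivatives. Uniqueness is the
  fundamental lemma of the calculus of variations (\<open>fundamental_lemma_L2\<close>): a square-integrable
  function orthogonal to all test functions is zero almost everywhere. The test functions
  needed for it are products of scaled and shifted copies of \<open>exp (-1/t)\<close> that approximate indicators of boxes.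
\<close>

section \<open>Smooth functions\<close>

lemma grad_has_derivative:
  assumes "(\<psi> has_derivative D) (at x)"
  shows "grad \<psi> x $ i = D (axis i 1)"
  using frechet_derivative_at[OF assms] by (simp add: grad_def)

lemma k_smooth_const: "k_smooth k (\<lambda>x. c)"
proof (induction k arbitrary: c)
  case (Suc k)
  have "grad (\<lambda>x. c) x $ i = 0" for x :: "real^'a" and i
    by (rule grad_has_derivative[OF has_derivative_const])
  then show ?case using Suc by simp
qed simp

lemma k_smooth_Suc_imp:
  "k_smooth (Suc k) \<psi> \<Longrightarrow> k_smooth k \<psi>"
proof (induction k arbitrary: \<psi>)
  case 0
  then show ?case
    by (auto intro!: differentiable_imp_continuous_on simp: differentiable_on_def
        intro: differentiable_at_withinI)
next
  case (Suc k)
  then show ?case by (metis k_smooth.simps(2))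
qed

lemma grad_add:
  assumes "f differentiable (at x)" "g differentiable (at x)"
  shows "grad (\<lambda>x. f x + g x) x $ i = grad f x $ i + grad g x $ i"
  using assms unfolding frechet_derivative_works
  by (subst grad_has_derivative[OF has_derivative_add]) (auto simp: grad_def)

lemma grad_mult:
  assumes "f differentiable (at x)" "g differentiable (at x)"
  shows "grad (\<lambda>x. f x * g x) x $ i = f x * grad g x $ i + grad f x $ i * g x"
  using assms unfolding frechet_derivative_works
  by (subst grad_has_derivative[OF has_derivative_mult]) (auto simp: grad_def)

lemma k_smooth_add:
  "k_smooth k f \<Longrightarrow> k_smooth k g \<Longrightarrow> k_smooth k (\<lambda>x. f x + g x)"
proof (induction k arbitrary: f g)
  case (Suc k)
  then show ?case by (auto simp: grad_add)
qed (auto intro: continuous_intros)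

text \<open>
  The product rule leaves one factor undifferentiated. The induction therefore also uses that each
  factor is smooth to one order less than assumed.
\<close>
lemma k_smooth_mult:
  "k_smooth k f \<Longrightarrow> k_smooth k g \<Longrightarrow> k_smooth k (\<lambda>x. f x * g x)"
proof (induction k arbitrary: f g)
  case (Suc k)
  have "k_smooth k f" "k_smooth k g"
    using Suc.prems by (auto intro: k_smooth_Suc_imp)
  with Suc show ?case by (auto simp: grad_mult intro!: k_smooth_add)
qed (auto intro: continuous_intros)

lemma k_smooth_prod:
  assumes "finite I" "\<And>i. i \<in> I \<Longrightarrow> k_smooth k (f i)"
  shows "k_smooth k (\<lambda>x. \<Prod>i\<in>I. f i x)"
  using assms by (induction I rule: finite_induct) (auto intro: k_smooth_const k_smooth_mult)

text \<open>
  The flat function \<open>exp (-1/t)\<close> on the positive half-line, extended by zero, is the standard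
  smooth function that is not analytic. All its derivatives have the form \<open>p (1/t) exp (-1/t)\<close> with
  \<open>p\<close> a polynomial. Carrying \<open>p\<close> as a parameter makes the family closed under differentiation, so that
  smoothness of every order follows by a single induction.
\<close>
definition flat_exp :: "real poly \<Rightarrow> real \<Rightarrow> real" where
  "flat_exp p t = (if t \<le> 0 then 0 else poly p (1 / t) * exp (- 1 / t))"

lemma tendsto_poly_mult_exp_neg:
  fixes p :: "real poly"
  shows "((\<lambda>s. poly p s * exp (- s)) \<longlongrightarrow> 0) at_top"
proof -
  have "((\<lambda>s. \<Sum>i\<le>degree p. coeff p i * (s ^ i / exp s)) \<longlongrightarrow> (\<Sum>i\<le>degree p. coeff p i * 0)) at_top"
    by (intro tendsto_intros tendsto_power_div_exp_0)
  then show ?thesis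
    by (simp add: poly_altdef exp_minus divide_inverse sum_distrib_right mult.assoc)
qed

text \<open>
  For \<open>t > 0\<close> the chain rule turns \<open>p\<close> into \<open>s\<^sup>2 (p - p')\<close> evaluated at \<open>s = 1/t\<close>. At the origin the
  right difference quotient is \<open>s p(s) exp(-s)\<close>, which tends to zero as \<open>s\<close> grows.
\<close>
lemma has_real_derivative_flat_exp:
  "(flat_exp p has_real_derivative flat_exp (monom 1 2 * (p - pderiv p)) t) (at t)"
proof (cases t "0 :: real" rule: linorder_cases)
  case less
  have "((\<lambda>_. 0) has_real_derivative 0) (at t)" by simp
  then have "(flat_exp p has_real_derivative 0) (at t)"
    by (rule has_field_derivative_transform_within_open[where S = "{..<0}"])
      (use less in \<open>auto simp: flat_exp_def\<close>)
  with less show ?thesis by (simp add: flat_exp_def)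
next
  case greater
  have "((\<lambda>t. poly p (1 / t) * exp (- 1 / t)) has_real_derivative
      poly (monom 1 2 * (p - pderiv p)) (1 / t) * exp (- 1 / t)) (at t)"
    using greater
    by (auto intro!: derivative_eq_intros simp: poly_monom divide_simps power2_eq_square)
      (simp add: algebra_simps)
  then have "(flat_exp p has_real_derivative
      poly (monom 1 2 * (p - pderiv p)) (1 / t) * exp (- 1 / t)) (at t)"
    by (rule has_field_derivative_transform_within_open[where S = "{0<..}"])
      (use greater in \<open>auto simp: flat_exp_def\<close>)
  with greater show ?thesis by (simp add: flat_exp_def)
next
  case equal
  have "((\<lambda>s. poly (pCons 0 p) s * exp (- s)) \<longlongrightarrow> 0) at_top"
    by (rule tendsto_poly_mult_exp_neg)
  then have "((\<lambda>h. poly (pCons 0 p) (inverse h) * exp (- inverse h)) \<longlongrightarrow> 0) (at_right 0)"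
    by (rule filterlim_compose[OF _ filterlim_inverse_at_top_right])
  then have R: "((\<lambda>h. (flat_exp p (0 + h) - flat_exp p 0) / h) \<longlongrightarrow> 0) (at_right 0)"
    by (rule Lim_transform_eventually)
      (auto simp: eventually_at_right_less flat_exp_def field_simps
        intro!: eventually_mono[OF eventually_at_right_less[of 0]])
  have "((\<lambda>h. 0) \<longlongrightarrow> 0) (at_left (0 :: real))" by simp
  then have L: "((\<lambda>h. (flat_exp p (0 + h) - flat_exp p 0) / h) \<longlongrightarrow> 0) (at_left 0)"
    by (rule Lim_transform_eventually)
      (auto simp: flat_exp_def eventually_at_filter)
  from L R have "(flat_exp p has_real_derivative 0) (at 0)"
    unfolding DERIV_def by (simp add: filterlim_split_at)
  with equal show ?thesis by (simp add: flat_exp_def)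
qed

lemma k_smooth_flat_exp:
  fixes c e :: real and i :: "'d::finite"
  shows "k_smooth k (\<lambda>x::real^'d. flat_exp p (c * x $ i + e))"
proof (induction k arbitrary: p)
  case 0
  have "isCont (flat_exp p) t" for t
    using has_real_derivative_flat_exp DERIV_isCont by blast
  then have "continuous_on UNIV (flat_exp p)" by (simp add: continuous_at_imp_continuous_on)
  then have "continuous_on UNIV (\<lambda>x::real^'d. flat_exp p (c * x $ i + e))"
    by (rule continuous_on_compose2) (auto intro!: continuous_intros)
  then show ?case by simp
next
  case (Suc k)
  let ?q = "monom 1 2 * (p - pderiv p)"
  have D: "((\<lambda>x::real^'d. flat_exp p (c * x $ i + e)) has_derivative
      (\<lambda>h. (c * h $ i) * flat_exp ?q (c * x $ i + e))) (at x)" for x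
  proof -
    have "((\<lambda>x::real^'d. c * x $ i + e) has_derivative (\<lambda>h. c * h $ i)) (at x)"
      by (rule derivative_eq_intros bounded_linear_imp_has_derivative[OF bounded_linear_vec_nth] refl | simp)+
    from DERIV_compose_FDERIV[OF has_real_derivative_flat_exp this]
    show ?thesis .
  qed
  have "k_smooth k (\<lambda>x. (c * axis j 1 $ i) * flat_exp ?q (c * x $ i + e))" for j
    by (intro k_smooth_mult k_smooth_const Suc.IH)
  then show ?case
    by (auto simp: grad_has_derivative[OF D] intro: differentiableI[OF D])
qed

section \<open>Test functions\<close>

text \<open>
  A product of flat functions, one for each face of the box; for \<open>n > 0\<close> it is positive exactly inside. As \<open>n\<close>
  grows each factor tends to the indicator of the corresponding half-space, so these test functions
  tend to the indicator of the open box and are dominated by it.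
\<close>
definition box_bump :: "real^'d \<Rightarrow> real^'d \<Rightarrow> nat \<Rightarrow> real^'d \<Rightarrow> real" where
  "box_bump a b n x =
     (\<Prod>i\<in>UNIV. flat_exp 1 (real n * (x $ i - a $ i)) * flat_exp 1 (real n * (b $ i - x $ i)))"

lemma flat_exp_one_bounds: "0 \<le> flat_exp 1 t" "flat_exp 1 t \<le> 1"
  by (auto simp: flat_exp_def)

lemma box_bump_bounds: "0 \<le> box_bump a b n x" "box_bump a b n x \<le> 1"
  unfolding box_bump_def
  by (intro prod_nonneg prod_le_1 ballI conjI mult_nonneg_nonneg mult_le_one flat_exp_one_bounds)+

lemma k_smooth_box_bump: "k_smooth k (box_bump a b n)"
proof -
  have "k_smooth k (\<lambda>x. flat_exp 1 (real n * x $ i + - real n * a $ i) *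
      flat_exp 1 (- real n * x $ i + real n * b $ i))" for i
    by (intro k_smooth_mult k_smooth_flat_exp)
  then show ?thesis
    unfolding box_bump_def[abs_def] by (intro k_smooth_prod) (simp_all add: algebra_simps)
qed

lemma box_bump_outside: "x \<notin> box a b \<Longrightarrow> box_bump a b n x = 0"
  by (auto simp: box_bump_def mem_box_cart flat_exp_def not_less mult_le_0_iff)

lemma box_bump_test_function:
  assumes "cbox a b \<subseteq> \<Omega>"
  shows "box_bump a b n \<in> test_functions \<Omega>"
proof -
  have "{x. box_bump a b n x \<noteq> 0} \<subseteq> cbox a b"
    using box_bump_outside box_subset_cbox by fastforce
  then have *: "closure {x. box_bump a b n x \<noteq> 0} \<subseteq> cbox a b"
    by (intro closure_minimal closed_cbox)
  then have "compact (closure {x. box_bump a b n x \<noteq> 0})"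
    by (meson bounded_cbox bounded_subset closed_closure compact_eq_bounded_closed)
  with * assms show ?thesis by (auto simp: test_functions_def k_smooth_box_bump)
qed

lemma box_bump_tendsto_indicator: "(\<lambda>n. box_bump a b n x) \<longlonglongrightarrow> indicator (box a b) x"
proof (cases "x \<in> box a b")
  case True
  have lim: "(\<lambda>n. flat_exp 1 (real n * t)) \<longlonglongrightarrow> 1" if "t > 0" for t :: real
  proof -
    have "filterlim (\<lambda>n. real n * t) at_top sequentially"
      using that by (intro filterlim_at_top_mult_tendsto_pos[OF tendsto_const])
        (auto simp: filterlim_real_sequentially)
    then have "(\<lambda>n. inverse (real n * t)) \<longlonglongrightarrow> 0"
      by (rule tendsto_inverse_0_at_top)
    then have "(\<lambda>n. exp (- inverse (real n * t))) \<longlonglongrightarrow> exp (- 0)"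
      by (intro tendsto_intros)
    then have "(\<lambda>n. exp (- inverse (real n * t))) \<longlonglongrightarrow> 1" by simp
    then show ?thesis
    proof (rule Lim_transform_eventually)
      show "\<forall>\<^sub>F n in sequentially. exp (- inverse (real n * t)) = flat_exp 1 (real n * t)"
        using eventually_gt_at_top[of 0]
        by eventually_elim (use that in \<open>auto simp: flat_exp_def mult_le_0_iff divide_inverse\<close>)
    qed
  qed
  have "(\<lambda>n. box_bump a b n x) \<longlonglongrightarrow> (\<Prod>i\<in>(UNIV::'a set). 1 * 1)"
    unfolding box_bump_def using True by (intro tendsto_prod tendsto_mult lim) (auto simp: mem_box_cart)
  with True show ?thesis by simp
qed (simp add: box_bump_outside)

lemma test_functions_continuous: "\<psi> \<in> test_functions \<Omega> \<Longrightarrow> continuous_on UNIV \<psi>"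
  unfolding test_functions_def using k_smooth.simps(1) by blast

text \<open>
  Differentiating does not enlarge the support. This makes \<open>u \<partial>\<^sub>i\<psi>\<close> integrable for
  square-integrable \<open>u\<close>, hence the integrals in the definition of a weak gradient linear in \<open>u\<close>.
\<close>
lemma grad_test_function:
  assumes "\<psi> \<in> test_functions \<Omega>"
  shows "(\<lambda>x. grad \<psi> x $ i) \<in> test_functions \<Omega>"
proof -
  let ?K = "closure {x. \<psi> x \<noteq> 0}"
  have "grad \<psi> x $ i = 0" if "x \<notin> ?K" for x
  proof -
    have zero: "0 = \<psi> y" if "y \<in> - ?K" for y
      using that closure_subset[of "{x. \<psi> x \<noteq> 0}"] by auto
    have "(\<psi> has_derivative (\<lambda>h. 0)) (at x)"
      by (rule has_derivative_transform_within_open[OF has_derivative_const _ _ zero, of "- ?K"])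
        (use \<open>x \<notin> ?K\<close> in auto)
    then show ?thesis by (rule grad_has_derivative)
  qed
  then have "{x. grad \<psi> x $ i \<noteq> 0} \<subseteq> ?K" by blast
  then have *: "closure {x. grad \<psi> x $ i \<noteq> 0} \<subseteq> ?K" by (intro closure_minimal closed_closure)
  then have "compact (closure {x. grad \<psi> x $ i \<noteq> 0})"
    using assms compact_Int_closed[of ?K "closure {x. grad \<psi> x $ i \<noteq> 0}"]
    by (simp add: test_functions_def Int_absorb1)
  moreover have "k_smooth k (\<lambda>x. grad \<psi> x $ i)" for k
  proof -
    have "k_smooth (Suc k) \<psi>" using assms unfolding test_functions_def by blast
    then show ?thesis by simp
  qed
  ultimately show ?thesis using * assms by (auto simp: test_functions_def)
qed

section \<open>Square-integrable functions\<close>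

lemma L2_measurable: "u \<in> L2 \<Omega> \<Longrightarrow> u \<in> borel_measurable (lebesgue_on \<Omega>)"
  by (simp add: L2_def)

lemma L2_inner_integrable:
  fixes u v :: "real^'d \<Rightarrow> 'b::euclidean_space"
  assumes "u \<in> L2 \<Omega>" "v \<in> L2 \<Omega>"
  shows "integrable (lebesgue_on \<Omega>) (\<lambda>x. u x \<bullet> v x)"
proof (rule Bochner_Integration.integrable_bound)
  show "integrable (lebesgue_on \<Omega>) (\<lambda>x. (norm (u x))\<^sup>2 + (norm (v x))\<^sup>2)"
    using assms by (simp add: L2_def)
  show "(\<lambda>x. u x \<bullet> v x) \<in> borel_measurable (lebesgue_on \<Omega>)"
    using assms[THEN L2_measurable] by (rule borel_measurable_inner)
  have "norm (u x \<bullet> v x) \<le> norm ((norm (u x))\<^sup>2 + (norm (v x))\<^sup>2)" for x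
  proof -
    have "\<bar>u x \<bullet> v x\<bar> \<le> norm (u x) * norm (v x)" by (rule Cauchy_Schwarz_ineq2)
    moreover have "2 * (norm (u x) * norm (v x)) \<le> (norm (u x))\<^sup>2 + (norm (v x))\<^sup>2"
      using sum_squares_bound[of "norm (u x)" "norm (v x)"] by (simp add: mult.assoc)
    moreover have "0 \<le> norm (u x) * norm (v x)" by simp
    ultimately show ?thesis by (simp add: abs_of_nonneg)
  qed
  then show "AE x in lebesgue_on \<Omega>. norm (u x \<bullet> v x) \<le> norm ((norm (u x))\<^sup>2 + (norm (v x))\<^sup>2)"
    by simp
qed

lemma L2_mult_integrable:
  fixes u v :: "real^'d \<Rightarrow> real"
  assumes "u \<in> L2 \<Omega>" "v \<in> L2 \<Omega>"
  shows "integrable (lebesgue_on \<Omega>) (\<lambda>x. u x * v x)"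
  using L2_inner_integrable[OF assms] by simp

lemma L2_lincomb:
  fixes u v :: "real^'d \<Rightarrow> 'b::euclidean_space"
  assumes u: "u \<in> L2 \<Omega>" and v: "v \<in> L2 \<Omega>"
  shows "(\<lambda>x. a *\<^sub>R u x + b *\<^sub>R v x) \<in> L2 \<Omega>"
proof -
  have "(norm (a *\<^sub>R u x + b *\<^sub>R v x))\<^sup>2 =
      a\<^sup>2 * (u x \<bullet> u x) + 2 * a * b * (u x \<bullet> v x) + b\<^sup>2 * (v x \<bullet> v x)" for x
    unfolding power2_norm_eq_inner
    by (simp add: inner_add_left inner_add_right inner_commute[of "v x" "u x"] algebra_simps power2_eq_square)
  moreover have "integrable (lebesgue_on \<Omega>)
      (\<lambda>x. a\<^sup>2 * (u x \<bullet> u x) + 2 * a * b * (u x \<bullet> v x) + b\<^sup>2 * (v x \<bullet> v x))"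
    using L2_inner_integrable[OF u u] L2_inner_integrable[OF u v] L2_inner_integrable[OF v v] by simp
  ultimately show ?thesis
    using u v by (auto simp: L2_def)
qed

lemma L2_mult_lincomb:
  fixes u v :: "real^'d \<Rightarrow> real"
  assumes "u \<in> L2 \<Omega>" "v \<in> L2 \<Omega>"
  shows "(\<lambda>x. a * u x + b * v x) \<in> L2 \<Omega>"
  using L2_lincomb[OF assms, of a b] by simp

lemma L2_bound:
  fixes u :: "real^'d \<Rightarrow> 'b::euclidean_space" and v :: "real^'d \<Rightarrow> 'c::euclidean_space"
  assumes "u \<in> L2 \<Omega>" "v \<in> borel_measurable (lebesgue_on \<Omega>)" "\<And>x. norm (v x) \<le> norm (u x)"
  shows "v \<in> L2 \<Omega>"
proof -
  have "integrable (lebesgue_on \<Omega>) (\<lambda>x. (norm (v x))\<^sup>2)"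
    by (rule Bochner_Integration.integrable_bound[where f = "\<lambda>x. (norm (u x))\<^sup>2"])
      (use assms in \<open>auto simp: L2_def intro!: power_mono\<close>)
  with assms show ?thesis by (simp add: L2_def)
qed

lemma L2_component:
  fixes G :: "real^'d \<Rightarrow> real^'d"
  assumes "G \<in> L2 \<Omega>"
  shows "(\<lambda>x. G x $ i) \<in> L2 \<Omega>"
proof (rule L2_bound[OF assms])
  have "(\<lambda>x. G x \<bullet> axis i 1) \<in> borel_measurable (lebesgue_on \<Omega>)"
    using L2_measurable[OF assms] by simp
  then show "(\<lambda>x. G x $ i) \<in> borel_measurable (lebesgue_on \<Omega>)"
    by (simp add: inner_axis)
  show "norm (G x $ i) \<le> norm (G x)" for x
    using component_le_norm_cart[of "G x" i] by simp
qed

lemma indicator_L2: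
  fixes \<Omega> K :: "(real^'d) set"
  assumes \<Omega>: "\<Omega> \<in> sets lebesgue" and K: "K \<in> lmeasurable"
  shows "(indicator K :: _ \<Rightarrow> real) \<in> L2 \<Omega>"
proof -
  have "integrable lebesgue (indicator K :: _ \<Rightarrow> real)"
    using K by (intro integrable_real_indicator) (auto simp: fmeasurable_def)
  then have "integrable (lebesgue_on \<Omega>) (indicator K :: _ \<Rightarrow> real)"
    using integrable_mult_indicator[OF \<Omega>, of "indicator K :: _ \<Rightarrow> real"]
    by (simp add: integrable_restrict_space \<Omega>)
  moreover have "(norm (indicator K x :: real))\<^sup>2 = indicator K x" for x
    by (simp add: indicator_def)
  ultimately show ?thesis by (simp add: L2_def borel_measurable_integrable)
qed

lemma test_function_L2:
  fixes \<Omega> :: "(real^'d) set"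
  assumes \<Omega>: "\<Omega> \<in> sets lebesgue" and \<psi>: "\<psi> \<in> test_functions \<Omega>"
  shows "\<psi> \<in> L2 \<Omega>"
proof -
  let ?K = "closure {x. \<psi> x \<noteq> 0}"
  have K: "compact ?K" using \<psi> by (simp add: test_functions_def)
  have cont: "continuous_on UNIV \<psi>" by (rule test_functions_continuous[OF \<psi>])
  have "compact (\<psi> ` ?K)"
    using K cont by (meson compact_continuous_image continuous_on_subset subset_UNIV)
  then obtain M where M: "\<And>y. y \<in> \<psi> ` ?K \<Longrightarrow> norm y \<le> M"
    using compact_imp_bounded bounded_iff by metis
  have "indicat_real ?K \<in> L2 \<Omega>" using indicator_L2[OF \<Omega> lmeasurable_compact[OF K]] .
  then have "(\<lambda>x. M * indicator ?K x) \<in> L2 \<Omega>"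
    using L2_mult_lincomb[of "indicator ?K" \<Omega> "indicator ?K" M 0] by simp
  then show ?thesis
  proof (rule L2_bound)
    have "\<psi> \<in> borel_measurable borel" using cont by (rule borel_measurable_continuous_onI)
    then show "\<psi> \<in> borel_measurable (lebesgue_on \<Omega>)"
      by (simp add: measurable_completion measurable_restrict_space1)
    show "norm (\<psi> x) \<le> norm (M * indicator ?K x)" for x
    proof (cases "x \<in> ?K")
      case True
      then show ?thesis using M[of "\<psi> x"] by auto
    next
      case False
      then show ?thesis using closure_subset[of "{x. \<psi> x \<noteq> 0}"] by auto
    qed
  qed
qed

section \<open>The fundamental lemma of the calculus of variations\<close>

text \<open>
  Boxes generate the Borel sets and are stable under intersection, so by a Dynkin argument the
  integral vanishes on every Borel set. Complements need the integral over the whole space, which is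
  the limit of the integrals over growing boxes.
\<close>
lemma AE_lborel_zero_if_zero_on_boxes:
  fixes v :: "'a::euclidean_space \<Rightarrow> real"
  assumes int: "integrable lborel v" and box: "\<And>a b. (LINT x:box a b|lborel. v x) = 0"
  shows "AE x in lborel. v x = 0"
proof -
  have set_int: "set_integrable lborel A v" if "A \<in> sets borel" for A
    using integrable_mult_indicator[OF _ int, of A] that by (simp add: set_integrable_def)
  have "(\<lambda>n::nat. LINT x|lborel. indicator (box (- (real n *\<^sub>R One)) (real n *\<^sub>R One)) x *\<^sub>R v x)
      \<longlonglongrightarrow> (LINT x|lborel. v x)"
  proof (rule integral_dominated_convergence[where w = "\<lambda>x. norm (v x)"])
    have "(\<lambda>n::nat. indicator (box (- (real n *\<^sub>R One)) (real n *\<^sub>R One)) x *\<^sub>R v x) \<longlonglongrightarrow> v x" for x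
    proof (rule tendsto_eventually)
      obtain m :: nat where m: "norm x < real m" using reals_Archimedean2 by blast
      have "x \<in> box (- (real n *\<^sub>R One)) (real n *\<^sub>R One)" if "n \<ge> m" for n
      proof -
        have "- real n < x \<bullet> b \<and> x \<bullet> b < real n" if "b \<in> Basis" for b
          using Basis_le_norm[OF that, of x] m \<open>n \<ge> m\<close> by linarith
        then show ?thesis by (simp add: mem_box)
      qed
      then show "\<forall>\<^sub>F n in sequentially. indicator (box (- (real n *\<^sub>R One)) (real n *\<^sub>R One)) x *\<^sub>R v x = v x"
        by (intro eventually_mono[OF eventually_ge_at_top[of m]]) simp
    qed
    then show "AE x in lborel. (\<lambda>n::nat. indicator (box (- (real n *\<^sub>R One)) (real n *\<^sub>R One)) x *\<^sub>R v x) \<longlonglongrightarrow> v x"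
      by simp
    show "\<And>i::nat. AE x in lborel. norm (indicator (box (- (real i *\<^sub>R One)) (real i *\<^sub>R One)) x *\<^sub>R v x) \<le> norm (v x)"
      by (simp add: indicator_def)
  qed (use int in auto)
  then have total: "(LINT x|lborel. v x) = 0"
    using box unfolding set_lebesgue_integral_def by (simp add: LIMSEQ_const_iff)
  have "(LINT x:A|lborel. v x) = 0" if "A \<in> sets borel" for A
  proof -
    let ?E = "range (\<lambda>(a, b). box a b :: 'a set)"
    have borel: "sets borel = sigma_sets UNIV ?E" by (simp add: borel_eq_box)
    have "Int_stable ?E" by (auto simp: Int_stable_def box_Int_box)
    moreover have "?E \<subseteq> Pow UNIV" by simp
    moreover have "A \<in> sigma_sets UNIV ?E" using that borel by simp
    ultimately show ?thesis
    proof (induction rule: sigma_sets_induct_disjoint)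
      case (basic A)
      then show ?case using box by auto
    next
      case empty
      show ?case by (simp add: set_lebesgue_integral_def)
    next
      case (compl A)
      then have A: "A \<in> sets borel" using borel by simp
      have "(LINT x:UNIV - A|lborel. v x) = (LINT x:UNIV|lborel. v x) - (LINT x:A|lborel. v x)"
      proof -
        have "(\<lambda>x. indicator (UNIV - A) x *\<^sub>R v x) = (\<lambda>x. v x - indicator A x *\<^sub>R v x)"
          by (auto simp: indicator_def)
        then show ?thesis
          using set_int[OF A] int unfolding set_lebesgue_integral_def set_integrable_def by simp
      qed
      with compl total show ?case by (simp add: set_lebesgue_integral_def)
    next
      case (union A)
      have A: "A i \<in> sets borel" for i using union(2) borel by auto
      have "(LINT x:(\<Union>i. A i)|lborel. v x) = (\<Sum>i. LINT x:A i|lborel. v x)"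
        by (rule lebesgue_integral_countable_add)
          (use A union(1) set_int in \<open>auto simp: disjoint_family_on_def\<close>)
      with union(3) show ?case by simp
    qed
  qed
  then show ?thesis
    using density_unique_real[OF int, of "\<lambda>_. 0"] by (simp add: set_lebesgue_integral_def)
qed

text \<open>
  A Lebesgue measurable function agrees almost everywhere with a Borel function, to which the
  previous lemma applies.
\<close>
lemma AE_zero_if_zero_on_boxes:
  fixes v :: "'a::euclidean_space \<Rightarrow> real"
  assumes int: "integrable lebesgue v" and box: "\<And>a b. (LINT x:box a b|lebesgue. v x) = 0"
  shows "AE x in lebesgue. v x = 0"
proof -
  obtain w where w: "w \<in> borel_measurable lborel" and eq: "AE x in lborel. v x = w x"
    using completion_ex_borel_measurable_real[OF borel_measurable_integrable[OF int]] by blast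
  have eq': "AE x in lebesgue. v x = w x" using eq by (rule AE_completion)
  have wl: "w \<in> borel_measurable lebesgue" using w by (rule measurable_completion)
  have "integrable lebesgue w"
    using integrable_cong_AE[OF borel_measurable_integrable[OF int] wl eq'] int by simp
  then have "integrable lborel w" using w by (simp add: integrable_completion)
  moreover have "(LINT x:box a b|lborel. w x) = 0" for a b
  proof -
    have "(LINT x:box a b|lborel. w x) = (LINT x:box a b|lebesgue. w x)"
      unfolding set_lebesgue_integral_def using w by (subst integral_completion) auto
    also have "\<dots> = (LINT x:box a b|lebesgue. v x)"
      by (rule set_lebesgue_integral_cong_AE) (use wl int eq' in auto)
    finally show ?thesis using box by simp
  qed
  ultimately have "AE x in lborel. w x = 0" by (rule AE_lborel_zero_if_zero_on_boxes)
  then have "AE x in lebesgue. w x = 0" by (rule AE_completion)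
  with eq' show ?thesis by eventually_elim simp
qed

text \<open>
  Bumps tend to the indicator of a box, so by dominated convergence \<open>u\<close> integrates to zero over every
  box whose closure lies in \<open>\<Omega>\<close>. Intersecting with further boxes shows that \<open>u\<close> restricted to such a
  box has zero integral on all boxes and hence vanishes there almost everywhere. The faces of a
  box are null sets, and countably many closed boxes cover \<open>\<Omega>\<close>.
\<close>
lemma fundamental_lemma_L2:
  fixes u :: "real^'d \<Rightarrow> real"
  assumes "open \<Omega>" and u: "u \<in> L2 \<Omega>"
    and orth: "\<And>\<psi>. \<psi> \<in> test_functions \<Omega> \<Longrightarrow> (LINT x|lebesgue_on \<Omega>. u x * \<psi> x) = 0"
  shows "AE x in lebesgue_on \<Omega>. u x = 0"
proof -
  have \<Omega>: "\<Omega> \<in> sets lebesgue" using \<open>open \<Omega>\<close> by simp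
  \<comment> \<open>The bumps vanish outside the box and are at most 1, so \<open>\<bar>u\<bar>\<close> times the indicator dominates.\<close>
  have box_zero: "(LINT x|lebesgue_on \<Omega>. u x * indicator (box a b) x) = 0"
    if "cbox a b \<subseteq> \<Omega>" for a b
  proof -
    have bb: "indicat_real (box a b) \<in> L2 \<Omega>" by (rule indicator_L2[OF \<Omega> lmeasurable_box])
    have "(\<lambda>n. LINT x|lebesgue_on \<Omega>. u x * box_bump a b n x)
        \<longlonglongrightarrow> (LINT x|lebesgue_on \<Omega>. u x * indicator (box a b) x)"
    proof (rule integral_dominated_convergence[where w = "\<lambda>x. \<bar>u x * indicator (box a b) x\<bar>"])
      show "AE x in lebesgue_on \<Omega>. (\<lambda>n. u x * box_bump a b n x) \<longlonglongrightarrow> u x * indicator (box a b) x"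
        by (intro AE_I2 tendsto_mult tendsto_const box_bump_tendsto_indicator)
      have "norm (u x * box_bump a b n x) \<le> \<bar>u x * indicator (box a b) x\<bar>" for n x
        using box_bump_bounds[of a b n x] box_bump_outside[of x a b n]
        by (auto simp: abs_mult indicator_def mult_left_le)
      then show "AE x in lebesgue_on \<Omega>. norm (u x * box_bump a b n x) \<le> \<bar>u x * indicator (box a b) x\<bar>" for n
        by simp
      show "integrable (lebesgue_on \<Omega>) (\<lambda>x. \<bar>u x * indicator (box a b) x\<bar>)"
        using L2_mult_integrable[OF u bb] by (rule integrable_abs)
      show "(\<lambda>x. u x * indicator (box a b) x) \<in> borel_measurable (lebesgue_on \<Omega>)"
        using L2_mult_integrable[OF u bb] by (rule borel_measurable_integrable)
      show "(\<lambda>x. u x * box_bump a b n x) \<in> borel_measurable (lebesgue_on \<Omega>)" for n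
        using L2_mult_integrable[OF u test_function_L2[OF \<Omega> box_bump_test_function[OF that]]]
        by (rule borel_measurable_integrable)
    qed
    then show ?thesis
      by (simp add: orth[OF box_bump_test_function[OF that]] LIMSEQ_const_iff)
  qed
  have local: "AE x in lebesgue. x \<in> cbox a b \<longrightarrow> u x = 0" if "cbox a b \<subseteq> \<Omega>" for a b
  proof -
    have bb: "indicat_real (box a b) \<in> L2 \<Omega>" by (rule indicator_L2[OF \<Omega> lmeasurable_box])
    have sub: "box a b \<subseteq> \<Omega>" using that box_subset_cbox by blast
    have ind: "indicator \<Omega> x * (u x * indicator (box a b) x) = u x * indicator (box a b) x" for x
      using sub by (auto simp: indicator_def)
    have "AE x in lebesgue. u x * indicator (box a b) x = 0"
    proof (rule AE_zero_if_zero_on_boxes)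
      show "integrable lebesgue (\<lambda>x. u x * indicator (box a b) x)"
        using L2_mult_integrable[OF u bb] by (simp add: integrable_restrict_space \<Omega> ind)
      show "(LINT x:box c d|lebesgue. u x * indicator (box a b) x) = 0" for c d
      proof -
        obtain p q where pq: "box a b \<inter> box c d = box p q"
          using box_Int_box by blast
        have "cbox p q \<subseteq> \<Omega>" if "box p q \<noteq> {}"
        proof -
          have "closure (box p q) = cbox p q" using that by simp
          moreover have "closure (box p q) \<subseteq> cbox a b"
            using pq box_subset_cbox[of a b] by (intro closure_minimal closed_cbox) blast
          ultimately show ?thesis using \<open>cbox a b \<subseteq> \<Omega>\<close> by simp
        qed
        then have "(LINT x|lebesgue_on \<Omega>. u x * indicator (box p q) x) = 0"
          using box_zero by (cases "box p q = {}") auto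
        moreover have "indicator \<Omega> x *\<^sub>R (u x * indicator (box p q) x) =
            indicator (box c d) x *\<^sub>R (u x * indicator (box a b) x)" for x
          using sub unfolding pq[symmetric] by (auto simp: indicator_def)
        moreover have "\<Omega> \<inter> space lebesgue \<in> sets lebesgue" using \<Omega> by simp
        ultimately show ?thesis
          unfolding set_lebesgue_integral_def by (simp only: integral_restrict_space)
      qed
    qed
    moreover have "AE x in lebesgue. x \<notin> cbox a b - box a b"
      by (rule AE_not_in) (use negligible_frontier_interval[of a b] in \<open>simp add: negligible_iff_null_sets\<close>)
    ultimately show ?thesis by eventually_elim (auto simp: indicator_def)
  qed
  obtain \<D> where \<D>: "countable \<D>" "\<D> \<subseteq> Pow \<Omega>" "\<And>X. X \<in> \<D> \<Longrightarrow> \<exists>a b. X = cbox a b" "\<Union>\<D> = \<Omega>"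
    using open_countable_Union_open_cbox[OF \<open>open \<Omega>\<close>] by metis
  have "AE x in lebesgue. \<forall>X\<in>\<D>. x \<in> X \<longrightarrow> u x = 0"
    unfolding AE_ball_countable[OF \<D>(1)]
  proof
    fix X assume "X \<in> \<D>"
    then obtain a b where "X = cbox a b" "X \<subseteq> \<Omega>" using \<D>(2,3) by blast
    then show "AE x in lebesgue. x \<in> X \<longrightarrow> u x = 0" using local[of a b] by simp
  qed
  then have "AE x in lebesgue. x \<in> \<Omega> \<longrightarrow> u x = 0"
    by eventually_elim (use \<D>(4) in blast)
  then show ?thesis by (simp add: AE_restrict_space_iff \<Omega>)
qed

section \<open>Weak gradient and weak Laplacian\<close>

text \<open>
  The representatives picked by \<open>wgrad\<close> and \<open>wlaplace\<close> are arbitrary, and neither operator need be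
  linear pointwise. Both are linear almost everywhere, because weak derivatives are unique up to null sets;
  this uniqueness is where the fundamental lemma enters.
\<close>
lemma AE_eq_if_orthogonal_eq:
  fixes u v :: "real^'d \<Rightarrow> real"
  assumes "open \<Omega>" and u: "u \<in> L2 \<Omega>" and v: "v \<in> L2 \<Omega>"
    and eq: "\<And>\<psi>. \<psi> \<in> test_functions \<Omega> \<Longrightarrow>
      (LINT x|lebesgue_on \<Omega>. u x * \<psi> x) = (LINT x|lebesgue_on \<Omega>. v x * \<psi> x)"
  shows "AE x in lebesgue_on \<Omega>. u x = v x"
proof -
  have "AE x in lebesgue_on \<Omega>. 1 * u x + (-1) * v x = 0"
  proof (rule fundamental_lemma_L2[OF \<open>open \<Omega>\<close> L2_mult_lincomb[OF u v]])
    fix \<psi> assume \<psi>: "\<psi> \<in> test_functions \<Omega>"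
    have "\<psi> \<in> L2 \<Omega>" by (rule test_function_L2[OF _ \<psi>]) (use \<open>open \<Omega>\<close> in simp)
    then show "(LINT x|lebesgue_on \<Omega>. (1 * u x + (-1) * v x) * \<psi> x) = 0"
      using L2_mult_integrable[OF u] L2_mult_integrable[OF v] eq[OF \<psi>]
      by (simp add: algebra_simps)
  qed
  then show ?thesis by simp
qed

lemma weak_gradient_unique:
  assumes "open \<Omega>" and G: "has_weak_gradient \<Omega> u G" and G': "has_weak_gradient \<Omega> u G'"
  shows "AE x in lebesgue_on \<Omega>. G x = G' x"
proof -
  have "AE x in lebesgue_on \<Omega>. G x $ i = G' x $ i" for i
  proof (rule AE_eq_if_orthogonal_eq[OF \<open>open \<Omega>\<close>])
    show "(LINT x|lebesgue_on \<Omega>. G x $ i * \<psi> x) = (LINT x|lebesgue_on \<Omega>. G' x $ i * \<psi> x)"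
      if "\<psi> \<in> test_functions \<Omega>" for \<psi>
    proof -
      have "(LINT x|lebesgue_on \<Omega>. u x * grad \<psi> x $ i) = - (LINT x|lebesgue_on \<Omega>. K x $ i * \<psi> x)"
        if "has_weak_gradient \<Omega> u K" for K
        using that \<open>\<psi> \<in> test_functions \<Omega>\<close> by (simp add: has_weak_gradient_def)
      from this[OF G] this[OF G'] show ?thesis by linarith
    qed
  qed (use G G' in \<open>auto simp: has_weak_gradient_def intro: L2_component\<close>)
  then have "AE x in lebesgue_on \<Omega>. \<forall>i\<in>UNIV. G x $ i = G' x $ i"
    by (subst AE_ball_countable) auto
  then show ?thesis by eventually_elim (simp add: vec_eq_iff)
qed

lemma weak_divergence_unique:
  assumes "open \<Omega>" and g: "has_weak_divergence \<Omega> G g" and g': "has_weak_divergence \<Omega> G g'"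
  shows "AE x in lebesgue_on \<Omega>. g x = g' x"
proof (rule AE_eq_if_orthogonal_eq[OF \<open>open \<Omega>\<close>])
  show "(LINT x|lebesgue_on \<Omega>. g x * \<psi> x) = (LINT x|lebesgue_on \<Omega>. g' x * \<psi> x)"
    if "\<psi> \<in> test_functions \<Omega>" for \<psi>
  proof -
    have "(LINT x|lebesgue_on \<Omega>. G x \<bullet> grad \<psi> x) = - (LINT x|lebesgue_on \<Omega>. k x * \<psi> x)"
      if "has_weak_divergence \<Omega> G k" for k
      using that \<open>\<psi> \<in> test_functions \<Omega>\<close> by (simp add: has_weak_divergence_def)
    from this[OF g] this[OF g'] show ?thesis by linarith
  qed
qed (use g g' in \<open>auto simp: has_weak_divergence_def\<close>)

lemma grad_test_function_L2:
  fixes \<psi> :: "real^'d \<Rightarrow> real"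
  assumes \<Omega>: "\<Omega> \<in> sets lebesgue" and \<psi>: "\<psi> \<in> test_functions \<Omega>"
  shows "grad \<psi> \<in> L2 \<Omega>"
proof -
  have i: "(\<lambda>x. grad \<psi> x $ i) \<in> L2 \<Omega>" for i
    by (rule test_function_L2[OF \<Omega> grad_test_function[OF \<psi>]])
  have "(\<lambda>x. \<Sum>i\<in>UNIV. grad \<psi> x $ i *\<^sub>R axis i (1::real)) \<in> borel_measurable (lebesgue_on \<Omega>)"
    using L2_measurable[OF i] by simp
  moreover have "(\<Sum>i\<in>UNIV. grad \<psi> x $ i *\<^sub>R axis i 1) = grad \<psi> x" for x
    by (simp add: vec_eq_iff axis_def if_distrib cong: if_cong)
  moreover have "integrable (lebesgue_on \<Omega>) (\<lambda>x. (norm (grad \<psi> x))\<^sup>2)"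
    unfolding power2_norm_eq_inner inner_vec_def
    by (intro Bochner_Integration.integrable_sum) (use L2_inner_integrable[OF i i] in simp)
  ultimately show ?thesis by (simp add: L2_def)
qed

lemma has_weak_gradient_lincomb:
  assumes \<Omega>: "\<Omega> \<in> sets lebesgue"
    and u: "has_weak_gradient \<Omega> u G" and v: "has_weak_gradient \<Omega> v H"
  shows "has_weak_gradient \<Omega> (\<lambda>x. a * u x + b * v x) (\<lambda>x. a *\<^sub>R G x + b *\<^sub>R H x)"
  unfolding has_weak_gradient_def
proof (intro conjI ballI allI)
  have L2: "u \<in> L2 \<Omega>" "v \<in> L2 \<Omega>" "G \<in> L2 \<Omega>" "H \<in> L2 \<Omega>"
    using u v by (auto simp: has_weak_gradient_def)
  then show "(\<lambda>x. a * u x + b * v x) \<in> L2 \<Omega>" "(\<lambda>x. a *\<^sub>R G x + b *\<^sub>R H x) \<in> L2 \<Omega>"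
    by (auto intro: L2_mult_lincomb L2_lincomb)
  fix \<psi> i assume \<psi>: "\<psi> \<in> test_functions \<Omega>"
  note [simp] = test_function_L2[OF \<Omega> \<psi>] test_function_L2[OF \<Omega> grad_test_function[OF \<psi>]]
  have "(LINT x|lebesgue_on \<Omega>. (a * u x + b * v x) * grad \<psi> x $ i) =
      a * (LINT x|lebesgue_on \<Omega>. u x * grad \<psi> x $ i) + b * (LINT x|lebesgue_on \<Omega>. v x * grad \<psi> x $ i)"
    by (simp add: distrib_right mult.assoc L2_mult_integrable L2)
  also have "\<dots> = - (a * (LINT x|lebesgue_on \<Omega>. G x $ i * \<psi> x) + b * (LINT x|lebesgue_on \<Omega>. H x $ i * \<psi> x))"
    using u v \<psi> by (simp add: has_weak_gradient_def)
  also have "\<dots> = - (LINT x|lebesgue_on \<Omega>. (a *\<^sub>R G x + b *\<^sub>R H x) $ i * \<psi> x)"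
    by (simp add: distrib_right mult.assoc L2_mult_integrable L2_component L2)
  finally show "(LINT x|lebesgue_on \<Omega>. (a * u x + b * v x) * grad \<psi> x $ i) =
      - (LINT x|lebesgue_on \<Omega>. (a *\<^sub>R G x + b *\<^sub>R H x) $ i * \<psi> x)" .
qed

lemma has_weak_divergence_lincomb:
  assumes \<Omega>: "\<Omega> \<in> sets lebesgue"
    and u: "has_weak_divergence \<Omega> G g" and v: "has_weak_divergence \<Omega> H h"
  shows "has_weak_divergence \<Omega> (\<lambda>x. a *\<^sub>R G x + b *\<^sub>R H x) (\<lambda>x. a * g x + b * h x)"
  unfolding has_weak_divergence_def
proof (intro conjI ballI)
  have L2: "g \<in> L2 \<Omega>" "h \<in> L2 \<Omega>" "G \<in> L2 \<Omega>" "H \<in> L2 \<Omega>"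
    using u v by (auto simp: has_weak_divergence_def)
  then show "(\<lambda>x. a * g x + b * h x) \<in> L2 \<Omega>" "(\<lambda>x. a *\<^sub>R G x + b *\<^sub>R H x) \<in> L2 \<Omega>"
    by (auto intro: L2_mult_lincomb L2_lincomb)
  fix \<psi> assume \<psi>: "\<psi> \<in> test_functions \<Omega>"
  note [simp] = test_function_L2[OF \<Omega> \<psi>] grad_test_function_L2[OF \<Omega> \<psi>]
  have "(LINT x|lebesgue_on \<Omega>. (a *\<^sub>R G x + b *\<^sub>R H x) \<bullet> grad \<psi> x) =
      a * (LINT x|lebesgue_on \<Omega>. G x \<bullet> grad \<psi> x) + b * (LINT x|lebesgue_on \<Omega>. H x \<bullet> grad \<psi> x)"
    by (simp add: inner_add_left L2_inner_integrable L2)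
  also have "\<dots> = - (a * (LINT x|lebesgue_on \<Omega>. g x * \<psi> x) + b * (LINT x|lebesgue_on \<Omega>. h x * \<psi> x))"
    using u v \<psi> by (simp add: has_weak_divergence_def)
  also have "\<dots> = - (LINT x|lebesgue_on \<Omega>. (a * g x + b * h x) * \<psi> x)"
    by (simp add: distrib_right mult.assoc L2_mult_integrable L2)
  finally show "(LINT x|lebesgue_on \<Omega>. (a *\<^sub>R G x + b *\<^sub>R H x) \<bullet> grad \<psi> x) =
      - (LINT x|lebesgue_on \<Omega>. (a * g x + b * h x) * \<psi> x)" .
qed

lemma has_weak_divergence_cong_AE:
  assumes \<Omega>: "\<Omega> \<in> sets lebesgue"
    and G: "has_weak_divergence \<Omega> G g" and H: "H \<in> L2 \<Omega>" and eq: "AE x in lebesgue_on \<Omega>. G x = H x"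
  shows "has_weak_divergence \<Omega> H g"
proof -
  have "(LINT x|lebesgue_on \<Omega>. H x \<bullet> grad \<psi> x) = (LINT x|lebesgue_on \<Omega>. G x \<bullet> grad \<psi> x)"
    if "\<psi> \<in> test_functions \<Omega>" for \<psi>
  proof (rule integral_cong_AE)
    have "G \<in> L2 \<Omega>" using G by (simp add: has_weak_divergence_def)
    with H show "(\<lambda>x. H x \<bullet> grad \<psi> x) \<in> borel_measurable (lebesgue_on \<Omega>)"
      "(\<lambda>x. G x \<bullet> grad \<psi> x) \<in> borel_measurable (lebesgue_on \<Omega>)"
      by (simp_all add: L2_inner_integrable grad_test_function_L2[OF \<Omega> that] borel_measurable_integrable)
    show "AE x in lebesgue_on \<Omega>. H x \<bullet> grad \<psi> x = G x \<bullet> grad \<psi> x"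
      using eq by eventually_elim simp
  qed
  with G H show ?thesis by (simp add: has_weak_divergence_def)
qed

lemma H1_has_weak_gradient: "u \<in> H1 \<Omega> \<Longrightarrow> has_weak_gradient \<Omega> u (wgrad \<Omega> u)"
  using someI_ex[of "has_weak_gradient \<Omega> u"] by (simp add: H1_def wgrad_def)

lemma H1_L2: "u \<in> H1 \<Omega> \<Longrightarrow> u \<in> L2 \<Omega>"
  using H1_has_weak_gradient unfolding has_weak_gradient_def by blast

lemma wgrad_L2: "u \<in> H1 \<Omega> \<Longrightarrow> wgrad \<Omega> u \<in> L2 \<Omega>"
  using H1_has_weak_gradient unfolding has_weak_gradient_def by blast

lemma H1_laplace_has_weak_divergence:
  "u \<in> H1_laplace \<Omega> \<Longrightarrow> has_weak_divergence \<Omega> (wgrad \<Omega> u) (wlaplace \<Omega> u)"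
  using someI_ex[of "has_weak_divergence \<Omega> (wgrad \<Omega> u)"] by (simp add: H1_laplace_def wlaplace_def)

lemma wlaplace_L2: "u \<in> H1_laplace \<Omega> \<Longrightarrow> wlaplace \<Omega> u \<in> L2 \<Omega>"
  using H1_laplace_has_weak_divergence unfolding has_weak_divergence_def by blast

lemma H1_lincomb:
  assumes "open \<Omega>" "u \<in> H1 \<Omega>" "v \<in> H1 \<Omega>"
  shows "(\<lambda>x. a * u x + b * v x) \<in> H1 \<Omega>"
  using has_weak_gradient_lincomb[OF _ assms(2,3)[THEN H1_has_weak_gradient]] assms(1)
  by (auto simp: H1_def)

lemma wgrad_lincomb:
  assumes "open \<Omega>" "u \<in> H1 \<Omega>" "v \<in> H1 \<Omega>"
  shows "AE x in lebesgue_on \<Omega>. wgrad \<Omega> (\<lambda>x. a * u x + b * v x) x = a *\<^sub>R wgrad \<Omega> u x + b *\<^sub>R wgrad \<Omega> v x"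
  by (rule weak_gradient_unique[OF assms(1) H1_has_weak_gradient has_weak_gradient_lincomb])
    (use assms in \<open>auto intro: H1_lincomb H1_has_weak_gradient\<close>)

lemma
  assumes "open \<Omega>" and u: "u \<in> H1_laplace \<Omega>" and v: "v \<in> H1_laplace \<Omega>"
  shows H1_laplace_lincomb: "(\<lambda>x. a * u x + b * v x) \<in> H1_laplace \<Omega>"
    and wlaplace_lincomb: "AE x in lebesgue_on \<Omega>.
      wlaplace \<Omega> (\<lambda>x. a * u x + b * v x) x = a * wlaplace \<Omega> u x + b * wlaplace \<Omega> v x"
proof -
  have \<Omega>: "\<Omega> \<in> sets lebesgue" using \<open>open \<Omega>\<close> by simp
  let ?w = "\<lambda>x. a * u x + b * v x"
  have H1: "u \<in> H1 \<Omega>" "v \<in> H1 \<Omega>" using u v by (auto simp: H1_laplace_def)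
  have w: "?w \<in> H1 \<Omega>" by (rule H1_lincomb[OF \<open>open \<Omega>\<close> H1])
  have "AE x in lebesgue_on \<Omega>. a *\<^sub>R wgrad \<Omega> u x + b *\<^sub>R wgrad \<Omega> v x = wgrad \<Omega> ?w x"
    using wgrad_lincomb[OF \<open>open \<Omega>\<close> H1, of a b] by eventually_elim simp
  then have div: "has_weak_divergence \<Omega> (wgrad \<Omega> ?w) (\<lambda>x. a * wlaplace \<Omega> u x + b * wlaplace \<Omega> v x)"
    by (rule has_weak_divergence_cong_AE[OF \<Omega> has_weak_divergence_lincomb[OF \<Omega>
        u[THEN H1_laplace_has_weak_divergence] v[THEN H1_laplace_has_weak_divergence]] wgrad_L2[OF w]])
  then show *: "?w \<in> H1_laplace \<Omega>" using w by (auto simp: H1_laplace_def)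
  show "AE x in lebesgue_on \<Omega>. wlaplace \<Omega> ?w x = a * wlaplace \<Omega> u x + b * wlaplace \<Omega> v x"
    by (rule weak_divergence_unique[OF \<open>open \<Omega>\<close> H1_laplace_has_weak_divergence[OF *] div])
qed

text \<open>
  Green's identity, with the boundary term removed by the Neumann condition. All
  integrations by parts in the energy estimate are instances of it.
\<close>
lemma neumann_green:
  assumes u: "homogeneous_neumann \<Omega> u" and v: "v \<in> H1 \<Omega>"
  shows "(LINT x|lebesgue_on \<Omega>. wlaplace \<Omega> u x * v x) =
    - (LINT x|lebesgue_on \<Omega>. wgrad \<Omega> u x \<bullet> wgrad \<Omega> v x)"
proof -
  have u': "u \<in> H1_laplace \<Omega>" "u \<in> H1 \<Omega>"
    using u by (auto simp: homogeneous_neumann_def H1_laplace_def)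
  have "0 = (LINT x|lebesgue_on \<Omega>. wgrad \<Omega> u x \<bullet> wgrad \<Omega> v x + wlaplace \<Omega> u x * v x)"
    using u v by (simp add: homogeneous_neumann_def normal_derivative_def)
  also have "\<dots> = (LINT x|lebesgue_on \<Omega>. wgrad \<Omega> u x \<bullet> wgrad \<Omega> v x) + (LINT x|lebesgue_on \<Omega>. wlaplace \<Omega> u x * v x)"
    using u' v by (intro Bochner_Integration.integral_add L2_inner_integrable L2_mult_integrable)
      (auto intro: wgrad_L2 wlaplace_L2 H1_L2)
  finally show ?thesis by simp
qed

text \<open>
  The midpoint and the increment of two consecutive phase fields inherit the Neumann condition and can
  therefore be integrated by parts. Their weak derivatives are compared with those of the summands
  almost everywhere, under the integral.
\<close>
lemma homogeneous_neumann_lincomb: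
  assumes "open \<Omega>" and u: "homogeneous_neumann \<Omega> u" and v: "homogeneous_neumann \<Omega> v"
  shows "homogeneous_neumann \<Omega> (\<lambda>x. a * u x + b * v x)"
  unfolding homogeneous_neumann_def
proof (intro conjI ballI)
  let ?w = "\<lambda>x. a * u x + b * v x"
  have lap: "u \<in> H1_laplace \<Omega>" "v \<in> H1_laplace \<Omega>"
    using u v by (auto simp: homogeneous_neumann_def)
  then have H1: "u \<in> H1 \<Omega>" "v \<in> H1 \<Omega>" by (auto simp: H1_laplace_def)
  show w: "?w \<in> H1_laplace \<Omega>" by (rule H1_laplace_lincomb[OF \<open>open \<Omega>\<close> lap])
  then have wH1: "?w \<in> H1 \<Omega>" by (auto simp: H1_laplace_def)
  fix z assume z: "z \<in> H1 \<Omega>"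
  have int: "integrable (lebesgue_on \<Omega>) (\<lambda>x. wgrad \<Omega> y x \<bullet> wgrad \<Omega> z x + wlaplace \<Omega> y x * z x)"
    if "y \<in> H1_laplace \<Omega>" for y
  proof -
    have "y \<in> H1 \<Omega>" using that by (simp add: H1_laplace_def)
    with that z show ?thesis
      by (intro Bochner_Integration.integrable_add L2_inner_integrable L2_mult_integrable)
        (simp_all add: wgrad_L2 wlaplace_L2 H1_L2)
  qed
  have "normal_derivative \<Omega> ?w z = (LINT x|lebesgue_on \<Omega>.
      a * (wgrad \<Omega> u x \<bullet> wgrad \<Omega> z x + wlaplace \<Omega> u x * z x) +
      b * (wgrad \<Omega> v x \<bullet> wgrad \<Omega> z x + wlaplace \<Omega> v x * z x))"
    unfolding normal_derivative_def
  proof (rule integral_cong_AE)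
    show "AE x in lebesgue_on \<Omega>. wgrad \<Omega> ?w x \<bullet> wgrad \<Omega> z x + wlaplace \<Omega> ?w x * z x =
      a * (wgrad \<Omega> u x \<bullet> wgrad \<Omega> z x + wlaplace \<Omega> u x * z x) +
      b * (wgrad \<Omega> v x \<bullet> wgrad \<Omega> z x + wlaplace \<Omega> v x * z x)"
      using wgrad_lincomb[OF \<open>open \<Omega>\<close> H1, of a b] wlaplace_lincomb[OF \<open>open \<Omega>\<close> lap, of a b]
      by eventually_elim (simp add: inner_add_left algebra_simps)
  qed (use int[OF w] int[OF lap(1)] int[OF lap(2)] in auto)
  also have "\<dots> = a * normal_derivative \<Omega> u z + b * normal_derivative \<Omega> v z"
    using int lap by (simp add: normal_derivative_def)
  also have "\<dots> = 0" using u v z by (simp add: homogeneous_neumann_def)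
  finally show "normal_derivative \<Omega> ?w z = 0" .
qed

section \<open>The potential\<close>

text \<open>
  The derivative of \<open>f\<close> exists everywhere but may be discontinuous; hence Taylor's theorem with the
  Lagrange remainder rather than an integral remainder.
\<close>
lemma quadratic_remainder_bound:
  fixes F f :: "real \<Rightarrow> real"
  assumes F: "\<And>s. (F has_real_derivative f s) (at s)"
    and f: "\<And>s. f differentiable (at s)" and bound: "\<And>s. \<bar>deriv f s\<bar> \<le> L"
  shows "\<bar>F a - F b - f b * (a - b)\<bar> \<le> L / 2 * (a - b)\<^sup>2"
proof (cases "a = b")
  case False
  define D where "D m = (if m = 0 then F else if m = 1 then f else deriv f)" for m :: nat
  have "(f has_real_derivative deriv f t) (at t)" for t
    using f DERIV_deriv_iff_real_differentiable by blast
  then have "\<forall>m t. m < 2 \<and> min a b \<le> t \<and> t \<le> max a b \<longrightarrow> (D m has_real_derivative D (Suc m) t) (at t)"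
    using F by (auto simp: D_def less_2_cases_iff)
  then obtain t where "F a = (\<Sum>m<2. D m b / fact m * (a - b) ^ m) + D 2 t / fact 2 * (a - b) ^ 2"
    using Taylor[of 2 D F "min a b" "max a b" b a] False by (auto simp: D_def)
  then have eq: "F a - F b - f b * (a - b) = deriv f t / 2 * (a - b)\<^sup>2"
    by (simp add: D_def numeral_2_eq_2)
  show ?thesis
    unfolding eq using mult_right_mono[OF bound[of t], of "(a - b)\<^sup>2"] by (simp add: abs_mult)
qed simp

text \<open>
  Both \<open>p\<close> and \<open>q\<close> are compared with the extrapolated point \<open>y = 3q/2 - r/2\<close> at which the scheme
  evaluates \<open>f\<close>. The two quadratic remainders are \<open>(p - y)\<^sup>2\<close> and \<open>(q - y)\<^sup>2\<close>, where
  \<open>p - y = (p - q) - (q - r)/2\<close> and \<open>q - y = -(q - r)/2\<close>; together they are dominated by the three squares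
  that the modified energy and its dissipation control.
\<close>
lemma extrapolated_potential_bound:
  fixes F f :: "real \<Rightarrow> real"
  assumes F: "\<And>s. (F has_real_derivative f s) (at s)"
    and f: "\<And>s. f differentiable (at s)" and bound: "\<And>s. \<bar>deriv f s\<bar> \<le> L" and "L \<ge> 0"
  shows "F p - F q - f (3 / 2 * q - 1 / 2 * r) * (p - q) \<le>
    L / 4 * ((p - q)\<^sup>2 + (q - r)\<^sup>2 + (p - 2 * q + r)\<^sup>2)"
proof -
  let ?y = "3 / 2 * q - 1 / 2 * r"
  have "F p - F q - f ?y * (p - q) =
      (F p - F ?y - f ?y * (p - ?y)) - (F q - F ?y - f ?y * (q - ?y))"
    by (simp add: algebra_simps)
  also have "\<dots> \<le> L / 2 * (p - ?y)\<^sup>2 + L / 2 * (q - ?y)\<^sup>2"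
    using quadratic_remainder_bound[OF F f bound, of p ?y] quadratic_remainder_bound[OF F f bound, of q ?y]
    by linarith
  also have "\<dots> = L / 4 * ((p - q)\<^sup>2 + (q - r)\<^sup>2 + (p - 2 * q + r)\<^sup>2) - L / 4 * (q - r)\<^sup>2"
    by (simp add: power2_eq_square field_simps)
  also have "\<dots> \<le> L / 4 * ((p - q)\<^sup>2 + (q - r)\<^sup>2 + (p - 2 * q + r)\<^sup>2)"
    using \<open>L \<ge> 0\<close> by simp
  finally show ?thesis .
qed

lemma const_L2:
  fixes \<Omega> :: "(real^'d) set"
  assumes "\<Omega> \<in> lmeasurable"
  shows "(\<lambda>x. c :: real) \<in> L2 \<Omega>"
  using assms finite_measure.integrable_const[OF finite_measure_lebesgue_on, of \<Omega> "c\<^sup>2"]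
  by (simp add: L2_def)

text \<open>
  A function with bounded derivative grows at most linearly, so composition with it preserves \<open>L\<^sup>2\<close>
  on a set of finite measure. For the same reason \<open>F\<close>, the primitive of such a function, grows at most
  quadratically and the potential energy of an \<open>L\<^sup>2\<close> function is finite.
\<close>
lemma Lipschitz_compose_L2:
  fixes u f :: "_ \<Rightarrow> real"
  assumes \<Omega>: "\<Omega> \<in> lmeasurable" and u: "u \<in> L2 \<Omega>"
    and f: "\<And>s. f differentiable (at s)" and bound: "\<And>s. \<bar>deriv f s\<bar> \<le> L" and "L \<ge> 0"
  shows "(\<lambda>x. f (u x)) \<in> L2 \<Omega>"
proof (rule L2_bound)
  have "(\<lambda>x. \<bar>u x\<bar>) \<in> L2 \<Omega>"
    by (rule L2_bound[OF u]) (use L2_measurable[OF u] in auto)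
  then show "(\<lambda>x. \<bar>f 0\<bar> * 1 + L * \<bar>u x\<bar>) \<in> L2 \<Omega>"
    by (rule L2_mult_lincomb[OF const_L2[OF \<Omega>]])
  have "continuous_on UNIV f"
    using f by (simp add: continuous_at_imp_continuous_on differentiable_imp_continuous_within)
  then show "(\<lambda>x. f (u x)) \<in> borel_measurable (lebesgue_on \<Omega>)"
    using L2_measurable[OF u] by (rule borel_measurable_continuous_on)
  have "(f has_real_derivative deriv f t) (at t)" for t
    using f DERIV_deriv_iff_real_differentiable by blast
  then have "\<bar>f s - f 0\<bar> \<le> L * \<bar>s - 0\<bar>" for s
    using field_differentiable_bound[of UNIV f "deriv f" L s 0] bound by simp
  then have "\<bar>f s\<bar> \<le> \<bar>f 0\<bar> + L * \<bar>s\<bar>" for s by (smt (verit))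
  then show "norm (f (u x)) \<le> norm (\<bar>f 0\<bar> * 1 + L * \<bar>u x\<bar>)" for x
    using \<open>L \<ge> 0\<close> by (simp add: abs_of_nonneg)
qed

lemma potential_integrable:
  fixes u F f :: "_ \<Rightarrow> real"
  assumes \<Omega>: "\<Omega> \<in> lmeasurable" and u: "u \<in> L2 \<Omega>"
    and F: "\<And>s. (F has_real_derivative f s) (at s)"
    and f: "\<And>s. f differentiable (at s)" and bound: "\<And>s. \<bar>deriv f s\<bar> \<le> L"
  shows "integrable (lebesgue_on \<Omega>) (\<lambda>x. F (u x))"
proof (rule Bochner_Integration.integrable_bound)
  let ?g = "\<lambda>x. \<bar>F 0\<bar> + \<bar>f 0 * u x\<bar> + L / 2 * (u x * u x)"
  have const: "integrable (lebesgue_on \<Omega>) (\<lambda>x. c :: real)" for c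
    by (rule finite_measure.integrable_const[OF finite_measure_lebesgue_on[OF \<Omega>]])
  show "integrable (lebesgue_on \<Omega>) ?g"
    using const[of "\<bar>F 0\<bar>"] L2_mult_integrable[OF u u] L2_mult_integrable[OF const_L2[OF \<Omega>, of "f 0"] u]
    by simp
  have "continuous_on UNIV F"
    using F by (meson DERIV_isCont continuous_at_imp_continuous_on)
  then show "(\<lambda>x. F (u x)) \<in> borel_measurable (lebesgue_on \<Omega>)"
    using L2_measurable[OF u] by (rule borel_measurable_continuous_on)
  have "\<bar>F s\<bar> \<le> \<bar>F 0\<bar> + \<bar>f 0 * s\<bar> + L / 2 * (s * s)" for s
  proof -
    have "\<bar>F s - F 0 - f 0 * s\<bar> \<le> L / 2 * (s * s)"
      using quadratic_remainder_bound[OF F f bound, of s 0] by (simp add: power2_eq_square)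
    then show ?thesis by linarith
  qed
  then show "AE x in lebesgue_on \<Omega>. norm (F (u x)) \<le> norm (?g x)"
    by (intro AE_I2) (smt (verit) real_norm_def)
qed

lemma energy_split:
  assumes u: "u \<in> H1 \<Omega>" and F: "integrable (lebesgue_on \<Omega>) (\<lambda>x. F (u x))"
  shows "energy \<Omega> \<epsilon> F u =
    \<epsilon> / 2 * (LINT x|lebesgue_on \<Omega>. wgrad \<Omega> u x \<bullet> wgrad \<Omega> u x) + (LINT x|lebesgue_on \<Omega>. F (u x)) / \<epsilon>"
  using L2_inner_integrable[OF wgrad_L2[OF u] wgrad_L2[OF u]] F
  by (simp add: energy_def power2_norm_eq_inner)

lemma L2_norm_power2: "(L2_norm \<Omega> u)\<^sup>2 = (LINT x|lebesgue_on \<Omega>. (u x)\<^sup>2)"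
  unfolding L2_norm_def by (rule real_sqrt_pow2) (simp add: Bochner_Integration.integral_nonneg)

section \<open>One step of the scheme\<close>

text \<open>
  Here \<open>p\<close>, \<open>q\<close>, \<open>r\<close> are the new, the current and the previous phase field and \<open>m\<close> is the chemical
  potential at the half step. Write \<open>d = p - q\<close>. Testing the evolution equation with \<open>m\<close> and the
  equation for \<open>m\<close> with \<open>d\<close> and comparing gives the exact energy balance \<open>balance\<close>. Testing the evolution
  equation with \<open>d\<close> itself expresses \<open>\<parallel>d\<parallel>\<^sup>2\<close> through \<open>\<nabla>m\<close> and \<open>\<nabla>d\<close>, and this interpolation between the two
  dissipation terms yields the gain \<open>2 sqrt (A/\<gamma>) \<parallel>d\<parallel>\<^sup>2\<close>.
\<close>
lemma energy_step:
  fixes \<Omega> :: "(real^'d) set" and p q r m :: "real^'d \<Rightarrow> real" and F f :: "real \<Rightarrow> real"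
  assumes "open \<Omega>" and \<Omega>: "\<Omega> \<in> lmeasurable"
    and F: "\<And>s. (F has_real_derivative f s) (at s)"
    and f: "\<And>s. f differentiable (at s)" and bound: "\<And>s. \<bar>deriv f s\<bar> \<le> L" and "L \<ge> 0"
    and "\<epsilon> > 0" "\<gamma> > 0" "\<tau> > 0" "A \<ge> 0"
    and p: "homogeneous_neumann \<Omega> p" and q: "homogeneous_neumann \<Omega> q" and r: "r \<in> L2 \<Omega>"
    and m: "homogeneous_neumann \<Omega> m"
    and scheme_p: "AE x in lebesgue_on \<Omega>. (p x - q x) / \<tau> = \<gamma> * wlaplace \<Omega> m x"
    and scheme_m: "AE x in lebesgue_on \<Omega>. m x =
        - \<epsilon> * wlaplace \<Omega> (\<lambda>y. (p y + q y) / 2) x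
        + 1 / \<epsilon> * f (3 / 2 * q x - 1 / 2 * r x)
        - A * \<tau> * wlaplace \<Omega> (\<lambda>y. p y - q y) x
        + B * (p x - 2 * q x + r x)"
  defines "Dpq \<equiv> LINT x|lebesgue_on \<Omega>. (p x - q x)\<^sup>2"
    and "Dqr \<equiv> LINT x|lebesgue_on \<Omega>. (q x - r x)\<^sup>2"
    and "Dpqr \<equiv> LINT x|lebesgue_on \<Omega>. (p x - 2 * q x + r x)\<^sup>2"
  shows "energy \<Omega> \<epsilon> F p + (L / (4 * \<epsilon>) + B / 2) * Dpq \<le>
    energy \<Omega> \<epsilon> F q + (L / (4 * \<epsilon>) + B / 2) * Dqr
    - (2 * sqrt (A / \<gamma>) - L / (2 * \<epsilon>)) * Dpq - (B / 2 - L / (4 * \<epsilon>)) * Dpqr"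
proof -
  let ?I = "\<lambda>h :: real^'d \<Rightarrow> real. integral\<^sup>L (lebesgue_on \<Omega>) h"
  define d where "d = (\<lambda>x. p x - q x)"
  define w where "w = (\<lambda>x. (p x + q x) / 2)"
  define e where "e = (\<lambda>x. p x - 2 * q x + r x)"
  define y where "y = (\<lambda>x. 3 / 2 * q x - 1 / 2 * r x)"
  have d_eq: "d = (\<lambda>x. 1 * p x + (-1) * q x)" and w_eq: "w = (\<lambda>x. 1 / 2 * p x + 1 / 2 * q x)"
    by (auto simp: d_def w_def)
  have d: "homogeneous_neumann \<Omega> d" and w: "homogeneous_neumann \<Omega> w"
    unfolding d_eq w_eq by (rule homogeneous_neumann_lincomb[OF \<open>open \<Omega>\<close> p q])+
  have lap: "u \<in> H1_laplace \<Omega>" if "homogeneous_neumann \<Omega> u" for u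
    using that by (simp add: homogeneous_neumann_def)
  have H1: "u \<in> H1 \<Omega>" if "homogeneous_neumann \<Omega> u" for u
    using lap[OF that] by (simp add: H1_laplace_def)
  note L2 = H1_L2[OF H1[OF p]] H1_L2[OF H1[OF q]] H1_L2[OF H1[OF d]] H1_L2[OF H1[OF m]]
    wgrad_L2[OF H1[OF p]] wgrad_L2[OF H1[OF q]] wgrad_L2[OF H1[OF d]] wgrad_L2[OF H1[OF w]] wgrad_L2[OF H1[OF m]]
    wlaplace_L2[OF lap[OF d]] wlaplace_L2[OF lap[OF w]] wlaplace_L2[OF lap[OF m]] r
  have qr: "(\<lambda>x. q x - r x) \<in> L2 \<Omega>"
    using L2_mult_lincomb[of q \<Omega> r 1 "-1"] L2 by simp
  have e: "e \<in> L2 \<Omega>"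
    using L2_mult_lincomb[of d \<Omega> "\<lambda>x. q x - r x" 1 "-1"] L2 qr
    by (simp add: d_def e_def algebra_simps)
  have y: "y \<in> L2 \<Omega>"
    using L2_mult_lincomb[of q \<Omega> r "3/2" "-1/2"] L2 by (simp add: y_def)
  have fy: "(\<lambda>x. f (y x)) \<in> L2 \<Omega>"
    by (rule Lipschitz_compose_L2[OF \<Omega> y f bound \<open>L \<ge> 0\<close>])
  note int [simp] = L2_mult_integrable L2_inner_integrable
  have wgrad_d: "AE x in lebesgue_on \<Omega>. wgrad \<Omega> d x = wgrad \<Omega> p x - wgrad \<Omega> q x"
    using wgrad_lincomb[OF \<open>open \<Omega>\<close> H1[OF p] H1[OF q], of 1 "-1"] by (simp add: d_eq)
  have wgrad_w: "AE x in lebesgue_on \<Omega>. wgrad \<Omega> w x = (1 / 2) *\<^sub>R wgrad \<Omega> p x + (1 / 2) *\<^sub>R wgrad \<Omega> q x"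
    using wgrad_lincomb[OF \<open>open \<Omega>\<close> H1[OF p] H1[OF q], of "1 / 2" "1 / 2"] by (simp add: w_eq)
  have evol: "AE x in lebesgue_on \<Omega>. d x = \<tau> * \<gamma> * wlaplace \<Omega> m x"
    using scheme_p by eventually_elim (use \<open>\<tau> > 0\<close> in \<open>simp add: d_def field_simps\<close>)
  \<comment> \<open>The evolution equation tested with an arbitrary \<open>v\<close>; used for \<open>v = m\<close> and \<open>v = d\<close>.\<close>
  have evol_test: "?I (\<lambda>x. d x * v x) = - \<tau> * \<gamma> * ?I (\<lambda>x. wgrad \<Omega> m x \<bullet> wgrad \<Omega> v x)"
    if "v \<in> H1 \<Omega>" for v
  proof -
    have "?I (\<lambda>x. d x * v x) = ?I (\<lambda>x. \<tau> * \<gamma> * (wlaplace \<Omega> m x * v x))"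
    proof (rule integral_cong_AE)
      show "AE x in lebesgue_on \<Omega>. d x * v x = \<tau> * \<gamma> * (wlaplace \<Omega> m x * v x)"
        using evol by eventually_elim simp
    qed (use L2 H1_L2[OF that] in \<open>auto intro!: borel_measurable_integrable\<close>)
    also have "\<dots> = - \<tau> * \<gamma> * ?I (\<lambda>x. wgrad \<Omega> m x \<bullet> wgrad \<Omega> v x)"
      by (simp add: neumann_green[OF m that])
    finally show ?thesis .
  qed
  define X where "X = ?I (\<lambda>x. wgrad \<Omega> d x \<bullet> wgrad \<Omega> d x)"
  define Y where "Y = ?I (\<lambda>x. wgrad \<Omega> m x \<bullet> wgrad \<Omega> m x)"
  define Z where "Z = ?I (\<lambda>x. wgrad \<Omega> m x \<bullet> wgrad \<Omega> d x)"
  define S where "S = ?I (\<lambda>x. f (y x) * d x)"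
  define Gp where "Gp = ?I (\<lambda>x. wgrad \<Omega> p x \<bullet> wgrad \<Omega> p x)"
  define Gq where "Gq = ?I (\<lambda>x. wgrad \<Omega> q x \<bullet> wgrad \<Omega> q x)"
  have test_m: "?I (\<lambda>x. m x * d x) = - \<tau> * \<gamma> * Y"
    using evol_test[OF H1[OF m]] by (simp add: Y_def mult.commute)
  have test_d: "Dpq = - \<tau> * \<gamma> * Z"
    using evol_test[OF H1[OF d]] by (simp add: Z_def Dpq_def d_def power2_eq_square)
  \<comment> \<open>The midpoint rule makes the gradient energies telescope: \<open>(a + b) \<bullet> (a - b) = a \<bullet> a - b \<bullet> b\<close>.\<close>
  have lap_w: "?I (\<lambda>x. wlaplace \<Omega> w x * d x) = - (Gp - Gq) / 2"
  proof -
    have "?I (\<lambda>x. wgrad \<Omega> w x \<bullet> wgrad \<Omega> d x) =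
        ?I (\<lambda>x. (wgrad \<Omega> p x \<bullet> wgrad \<Omega> p x - wgrad \<Omega> q x \<bullet> wgrad \<Omega> q x) / 2)"
    proof (rule integral_cong_AE)
      show "AE x in lebesgue_on \<Omega>. wgrad \<Omega> w x \<bullet> wgrad \<Omega> d x =
          (wgrad \<Omega> p x \<bullet> wgrad \<Omega> p x - wgrad \<Omega> q x \<bullet> wgrad \<Omega> q x) / 2"
        using wgrad_w wgrad_d
      proof eventually_elim
        case (elim x)
        have "((1 / 2) *\<^sub>R a + (1 / 2) *\<^sub>R b) \<bullet> (a - b) = (a \<bullet> a - b \<bullet> b) / 2" for a b :: "real^'d"
          by (simp add: inner_add_left inner_diff_right inner_commute[of b a] field_simps)
        then show ?case unfolding elim .
      qed
    qed (use L2 in \<open>auto intro!: borel_measurable_integrable\<close>)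
    also have "\<dots> = (Gp - Gq) / 2" using L2 by (simp add: Gp_def Gq_def)
    finally show ?thesis using neumann_green[OF w H1[OF d]] by simp
  qed
  have lap_d: "?I (\<lambda>x. wlaplace \<Omega> d x * d x) = - X"
    using neumann_green[OF d H1[OF d]] by (simp add: X_def)
  \<comment> \<open>Here \<open>e = d - (q - r)\<close>, and \<open>2 (a - b) a = a\<^sup>2 - b\<^sup>2 + (a - b)\<^sup>2\<close>.\<close>
  have B_term: "?I (\<lambda>x. e x * d x) = (Dpq - Dqr + Dpqr) / 2"
  proof -
    have "?I (\<lambda>x. e x * d x) =
        ?I (\<lambda>x. (d x * d x - (q x - r x) * (q x - r x) + e x * e x) / 2)"
      by (rule Bochner_Integration.integral_cong) (auto simp: e_def d_def field_simps)
    also have "\<dots> = (Dpq - Dqr + Dpqr) / 2"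
      using L2 qr e by (simp add: Dpq_def Dqr_def Dpqr_def d_def e_def power2_eq_square)
    finally show ?thesis .
  qed
  have "?I (\<lambda>x. m x * d x) = ?I (\<lambda>x. - \<epsilon> * (wlaplace \<Omega> w x * d x) + 1 / \<epsilon> * (f (y x) * d x)
      - A * \<tau> * (wlaplace \<Omega> d x * d x) + B * (e x * d x))"
  proof (rule integral_cong_AE)
    show "AE x in lebesgue_on \<Omega>. m x * d x = - \<epsilon> * (wlaplace \<Omega> w x * d x) + 1 / \<epsilon> * (f (y x) * d x)
      - A * \<tau> * (wlaplace \<Omega> d x * d x) + B * (e x * d x)"
      using scheme_m unfolding w_def[symmetric] d_def[symmetric]
    proof eventually_elim
      case (elim x)
      show ?case unfolding elim by (simp add: e_def y_def algebra_simps)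
    qed
  qed (use L2 fy e in \<open>auto intro!: borel_measurable_integrable\<close>)
  also have "\<dots> = - \<epsilon> * ?I (\<lambda>x. wlaplace \<Omega> w x * d x) + 1 / \<epsilon> * S
      - A * \<tau> * ?I (\<lambda>x. wlaplace \<Omega> d x * d x) + B * ?I (\<lambda>x. e x * d x)"
    using L2 fy e by (simp add: S_def)
  finally have balance: "- \<tau> * \<gamma> * Y = \<epsilon> / 2 * (Gp - Gq) + S / \<epsilon> + A * \<tau> * X + B / 2 * (Dpq - Dqr + Dpqr)"
    unfolding test_m lap_w lap_d B_term by (simp add: algebra_simps)
  \<comment> \<open>Expanding \<open>\<parallel>\<nabla>m + s \<nabla>d\<parallel>\<^sup>2 \<ge> 0\<close>; with \<open>s\<^sup>2 = A/\<gamma>\<close> the square terms are the dissipation divided by \<open>\<tau>\<gamma>\<close>, and the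
    mixed term is a multiple of \<open>\<parallel>d\<parallel>\<^sup>2\<close>.\<close>
  have dissipation: "2 * sqrt (A / \<gamma>) * Dpq \<le> \<tau> * \<gamma> * Y + A * \<tau> * X"
  proof -
    define s where "s = sqrt (A / \<gamma>)"
    have "0 \<le> ?I (\<lambda>x. (wgrad \<Omega> m x + s *\<^sub>R wgrad \<Omega> d x) \<bullet> (wgrad \<Omega> m x + s *\<^sub>R wgrad \<Omega> d x))"
      by (simp add: Bochner_Integration.integral_nonneg)
    also have "\<dots> = ?I (\<lambda>x. wgrad \<Omega> m x \<bullet> wgrad \<Omega> m x + 2 * s * (wgrad \<Omega> m x \<bullet> wgrad \<Omega> d x)
        + s\<^sup>2 * (wgrad \<Omega> d x \<bullet> wgrad \<Omega> d x))"
      by (rule Bochner_Integration.integral_cong)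
        (auto simp: inner_add_left inner_add_right inner_commute power2_eq_square)
    also have "\<dots> = Y + 2 * s * Z + s\<^sup>2 * X"
      using L2 by (simp add: X_def Y_def Z_def)
    also have "s\<^sup>2 = A / \<gamma>" using \<open>A \<ge> 0\<close> \<open>\<gamma> > 0\<close> by (simp add: s_def)
    finally have "0 \<le> \<tau> * \<gamma> * (Y + 2 * s * Z + A / \<gamma> * X)"
      using \<open>\<tau> > 0\<close> \<open>\<gamma> > 0\<close> by simp
    then show ?thesis using \<open>\<gamma> > 0\<close> by (simp add: test_d s_def algebra_simps)
  qed
  have Fint: "integrable (lebesgue_on \<Omega>) (\<lambda>x. F (p x))" "integrable (lebesgue_on \<Omega>) (\<lambda>x. F (q x))"
    by (rule potential_integrable[OF \<Omega> _ F f bound]; use L2 in blast)+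
  have potential: "?I (\<lambda>x. F (p x)) - ?I (\<lambda>x. F (q x)) - S \<le> L / 4 * (Dpq + Dqr + Dpqr)"
  proof -
    have "?I (\<lambda>x. F (p x)) - ?I (\<lambda>x. F (q x)) - S = ?I (\<lambda>x. F (p x) - F (q x) - f (y x) * d x)"
      using Fint L2 fy by (simp add: S_def)
    also have "\<dots> \<le> ?I (\<lambda>x. L / 4 * (d x * d x + (q x - r x) * (q x - r x) + e x * e x))"
    proof (rule integral_mono)
      show "F (p x) - F (q x) - f (y x) * d x \<le> L / 4 * (d x * d x + (q x - r x) * (q x - r x) + e x * e x)" for x
        using extrapolated_potential_bound[OF F f bound \<open>L \<ge> 0\<close>, of "p x" "q x" "r x"]
        by (simp add: d_def e_def y_def power2_eq_square)
    qed (use Fint L2 fy qr e in auto)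
    also have "\<dots> = L / 4 * (Dpq + Dqr + Dpqr)"
      using L2 qr e by (simp add: Dpq_def Dqr_def Dpqr_def d_def e_def power2_eq_square)
    finally show ?thesis .
  qed
  have "energy \<Omega> \<epsilon> F p - energy \<Omega> \<epsilon> F q =
      \<epsilon> / 2 * (Gp - Gq) + (?I (\<lambda>x. F (p x)) - ?I (\<lambda>x. F (q x))) / \<epsilon>"
    unfolding energy_split[OF H1[OF p] Fint(1)] energy_split[OF H1[OF q] Fint(2)] Gp_def Gq_def
    by (simp add: algebra_simps diff_divide_distrib)
  also have "\<dots> \<le> \<epsilon> / 2 * (Gp - Gq) + (S + L / 4 * (Dpq + Dqr + Dpqr)) / \<epsilon>"
    using potential \<open>\<epsilon> > 0\<close> by (intro add_left_mono divide_right_mono) auto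
  also have "\<dots> = \<epsilon> / 2 * (Gp - Gq) + S / \<epsilon> + L / (4 * \<epsilon>) * (Dpq + Dqr + Dpqr)"
    by (simp add: add_divide_distrib)
  also have "\<dots> = - (\<tau> * \<gamma> * Y + A * \<tau> * X) - B / 2 * (Dpq - Dqr + Dpqr) + L / (4 * \<epsilon>) * (Dpq + Dqr + Dpqr)"
    using balance by simp
  also have "\<dots> \<le> - (2 * sqrt (A / \<gamma>) * Dpq) - B / 2 * (Dpq - Dqr + Dpqr) + L / (4 * \<epsilon>) * (Dpq + Dqr + Dpqr)"
    using dissipation by simp
  finally have "energy \<Omega> \<epsilon> F p - energy \<Omega> \<epsilon> F q \<le>
      - (2 * sqrt (A / \<gamma>) * Dpq) - B / 2 * (Dpq - Dqr + Dpqr) + L / (4 * \<epsilon>) * (Dpq + Dqr + Dpqr)" .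
  moreover define l b where "l = L / (4 * \<epsilon>)" and "b = B / 2"
  moreover have "L / (2 * \<epsilon>) = 2 * l" by (simp add: l_def)
  ultimately show ?thesis
    unfolding \<open>L / (2 * \<epsilon>) = 2 * l\<close> l_def[symmetric] b_def[symmetric] by (simp add: algebra_simps)
qed

theorem theorem1:
  fixes \<Omega> :: "(real^'d) set"
    and F f :: "real \<Rightarrow> real"
    and \<phi> \<mu> :: "nat \<Rightarrow> real^'d \<Rightarrow> real"
    and L \<epsilon> \<gamma> \<tau> A B :: real
    and N :: nat
  assumes dim: "CARD('d) = 2 \<or> CARD('d) = 3"
    and domain: "lipschitz_domain \<Omega>"
    and potential: "\<And>s. (F has_real_derivative f s) (at s)"
    and f_diff: "\<And>s. f differentiable (at s)"
    and f_bound: "\<And>s. \<bar>deriv f s\<bar> \<le> L"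
    and L_nonneg: "L \<ge> 0"
    and params_pos: "\<epsilon> > 0" "\<gamma> > 0" "\<tau> > 0"
    and AB_nonneg: "A \<ge> 0" "B \<ge> 0"
    and phi_neumann: "\<And>k. k \<le> N + 1 \<Longrightarrow> homogeneous_neumann \<Omega> (\<phi> k)"
    and mu_neumann: "\<And>n. 1 \<le> n \<Longrightarrow> n \<le> N \<Longrightarrow> homogeneous_neumann \<Omega> (\<mu> n)"
    \<comment> \<open>\<open>\<mu> n\<close> is the chemical potential at the half step \<open>n + 1/2\<close>\<close>
    and scheme_phi: "\<And>n. 1 \<le> n \<Longrightarrow> n \<le> N \<Longrightarrow>
      AE x in lebesgue_on \<Omega>. (\<phi> (n + 1) x - \<phi> n x) / \<tau> = \<gamma> * wlaplace \<Omega> (\<mu> n) x"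
    and scheme_mu: "\<And>n. 1 \<le> n \<Longrightarrow> n \<le> N \<Longrightarrow>
      AE x in lebesgue_on \<Omega>. \<mu> n x =
        - \<epsilon> * wlaplace \<Omega> (\<lambda>y. (\<phi> (n + 1) y + \<phi> n y) / 2) x
        + 1 / \<epsilon> * f (3 / 2 * \<phi> n x - 1 / 2 * \<phi> (n - 1) x)
        - A * \<tau> * wlaplace \<Omega> (delta_t \<phi> (n + 1)) x
        + B * delta_tt \<phi> (n + 1) x"
    and A_large: "A \<ge> L\<^sup>2 / (16 * \<epsilon>\<^sup>2) * \<gamma>"
    and B_large: "B \<ge> L / (2 * \<epsilon>)"
  shows "\<forall>n. 1 \<le> n \<and> n \<le> N \<longrightarrow>
    modified_energy \<Omega> \<epsilon> F L B \<phi> (n + 1)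
      \<le> modified_energy \<Omega> \<epsilon> F L B \<phi> n
        - (2 * sqrt (A / \<gamma>) - L / (2 * \<epsilon>)) * (L2_norm \<Omega> (delta_t \<phi> (n + 1)))\<^sup>2
        - (B / 2 - L / (4 * \<epsilon>)) * (L2_norm \<Omega> (delta_tt \<phi> (n + 1)))\<^sup>2"
proof (intro allI impI)
  fix n assume "1 \<le> n \<and> n \<le> N"
  then have n: "1 \<le> n" "n \<le> N" by auto
  have "open \<Omega>" "bounded \<Omega>" using domain by (auto simp: lipschitz_domain_def)
  then have \<Omega>: "\<Omega> \<in> lmeasurable" by (simp add: lmeasurable_open)
  have dt: "delta_t \<phi> (n + 1) = (\<lambda>y. \<phi> (n + 1) y - \<phi> n y)" "delta_t \<phi> n = (\<lambda>y. \<phi> n y - \<phi> (n - 1) y)"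
    by (simp_all add: delta_t_def fun_eq_iff)
  have dtt: "delta_tt \<phi> (n + 1) = (\<lambda>y. \<phi> (n + 1) y - 2 * \<phi> n y + \<phi> (n - 1) y)"
    by (simp add: delta_tt_def fun_eq_iff)
  have "\<phi> (n - 1) \<in> L2 \<Omega>"
    using phi_neumann[of "n - 1"] n by (auto simp: homogeneous_neumann_def H1_laplace_def intro: H1_L2)
  moreover have "homogeneous_neumann \<Omega> (\<phi> (n + 1))" "homogeneous_neumann \<Omega> (\<phi> n)"
    using phi_neumann n by auto
  ultimately show "modified_energy \<Omega> \<epsilon> F L B \<phi> (n + 1)
      \<le> modified_energy \<Omega> \<epsilon> F L B \<phi> n
        - (2 * sqrt (A / \<gamma>) - L / (2 * \<epsilon>)) * (L2_norm \<Omega> (delta_t \<phi> (n + 1)))\<^sup>2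
        - (B / 2 - L / (4 * \<epsilon>)) * (L2_norm \<Omega> (delta_tt \<phi> (n + 1)))\<^sup>2"
    using energy_step[OF \<open>open \<Omega>\<close> \<Omega> potential f_diff f_bound L_nonneg params_pos AB_nonneg(1) _ _ _
        mu_neumann[OF n] scheme_phi[OF n] scheme_mu[OF n, unfolded dt dtt]]
    unfolding modified_energy_def L2_norm_power2 dt dtt by blast
qed

end
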